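(* For all $\lambda\in(1/2,1)$ there exists a real-analytic function $\tau:\mathbb{R}/\mathbb{Z}\to\mathbb{R}$ such that the attractor set $\Omega_{\lambda,\tau}$ of $A_{\lambda,\tau}(\theta,t)=(2\theta,\lambda t+\tau(\theta))$ has non-empty interior and is not a topological annulus. Moreover, this property is robust. That is, let $U=\mathbb{R}/\mathbb{Z}\times(-T_0,T_0)$ be such that $A_{\lambda,\tau}(\overline{U})\subset U$. Then there exists a neighborhood $\mathcal{U}$ of $A_{\lambda,\tau}$ in $\operatorname{Lip}(\overline{U},U)$ such that for all $F\in\mathcal{U}$ the attractor set $\Omega_F$ has non-empty interior and is not a topological annulus.
   Context: $\Omega_{\lambda,\tau}$ is the non-wandering set of $A_{\lambda,\tau}:\mathbb{R}/\mathbb{Z}\times\mathbb{R}\to\mathbb{R}/\mathbb{Z}\times\mathbb{R}$. A topological annulus here means a set homeomorphic to $\mathbb{R}/\mathbb{Z}\times[0,1]$. For an open set $U\subset\mathbb{R}/\mathbb{Z}\times\mathbb{R}$ with compact closure, $\operatorname{Lip}(\overline U,\mathbb{R}/\mathbb{Z}\times\mathbb{R})$ is the set of Lipschitz maps $F:\overline U\to\mathbb{R}/\mathbb{Z}\times\mathbb{R}$ with the metric $\operatorname{dist}_L(F_0,F_1)=\|F_0-F_1\|_\infty+\|f_0-f_1\|_L+\|g_0-g_1\|_L$, where $F_i=(f_i,g_i)$ and $\|\cdot\|_L$ is the best Lipschitz constant. $\operatorname{Lip}(\overline U,U)$ is the (open) subset of those $F$ with $F(\overline U)\subset U$, and for such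 $F$ the attractor is $\Omega_F=\bigcap_{n\ge0}F^n(\overline U)$. The restriction of $A_{\lambda,\tau}$ to $\overline U$ is regarded as an element of $\operatorname{Lip}(\overline U,U)$. *)

theory Defs
  imports "HOL-Analysis.Analysis"
begin

section \<open>The circle \<open>\<real>/\<int>\<close>\<close>

quotient_type circle = real / "\<lambda>x y :: real. x - y \<in> \<int>"
  morphisms rep_circle to_circle
proof (rule equivpI)
  show "reflp (\<lambda>x y :: real. x - y \<in> \<int>)"
    by (simp add: reflp_def)
  show "symp (\<lambda>x y :: real. x - y \<in> \<int>)"
    by (metis (mono_tags, lifting) Ints_minus minus_diff_eq sympI)
  show "transp (\<lambda>x y :: real. x - y \<in> \<int>)"
    by (rule transpI) (metis Ints_add add_diff_cancel_left' diff_add_cancel diff_diff_eq2 add.commute)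
qed

instantiation circle :: ab_group_add
begin

lift_definition zero_circle :: circle is "0" .

lift_definition plus_circle :: "circle \<Rightarrow> circle \<Rightarrow> circle" is "(+)"
  by (metis Ints_add add_diff_add)

lift_definition minus_circle :: "circle \<Rightarrow> circle \<Rightarrow> circle" is "(-)"
proof -
  fix a b c d :: real
  assume "a - b \<in> \<int>" "c - d \<in> \<int>"
  then have "(a - b) - (c - d) \<in> \<int>" by (rule Ints_diff)
  then show "(a - c) - (b - d) \<in> \<int>" by (simp add: algebra_simps)
qed

lift_definition uminus_circle :: "circle \<Rightarrow> circle" is "uminus"
  by (metis Ints_minus minus_diff_minus)

instance
  by standard (transfer; simp add: algebra_simps)+

end

text \<open>The flat metric: the distance from \<open>x - y\<close> to the nearest integer.\<close>

lemma infdist_Ints_uminus: "infdist (- x) \<int> = infdist (x :: real) \<int>"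
proof -
  have le: "infdist (- x) \<int> \<le> infdist x \<int>" for x :: real
  proof -
    have "infdist (- x) \<int> \<le> dist x a" if "a \<in> \<int>" for a
      using infdist_le[of "- a" \<int> "- x"] that by (simp add: dist_minus)
    then show ?thesis
      by (subst (2) infdist_notempty) (auto intro!: cINF_greatest)
  qed
  from le[of x] le[of "- x"] show ?thesis by simp
qed

lemma infdist_Ints_add: "infdist (x + y) \<int> \<le> infdist x \<int> + infdist (y :: real) \<int>"
proof -
  have ne: "(\<int> :: real set) \<noteq> {}" by auto
  obtain a where a: "a \<in> \<int>" "infdist x \<int> = dist x a"
    using infdist_attains_inf[OF closed_Ints ne] by blast
  obtain b where b: "b \<in> \<int>" "infdist y \<int> = dist y b"
    using infdist_attains_inf[OF closed_Ints ne] by blast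
  have "infdist (x + y) \<int> \<le> dist (x + y) (a + b)"
    using a b by (intro infdist_le) auto
  also have "\<dots> \<le> dist x a + dist y b"
    by (rule dist_triangle_add)
  finally show ?thesis using a b by simp
qed

lemma infdist_Ints_cong:
  assumes "x - y \<in> \<int>"
  shows "infdist x \<int> = infdist (y :: real) \<int>"
  using infdist_Ints_add[of "x - y" y] infdist_Ints_add[of "y - x" x] assms
    Ints_minus[OF assms] by simp

instantiation circle :: metric_space
begin

lift_definition dist_circle :: "circle \<Rightarrow> circle \<Rightarrow> real" is "\<lambda>x y. infdist (x - y) \<int>"
proof -
  fix a b c d :: real
  assume "a - b \<in> \<int>" "c - d \<in> \<int>"
  then have "(a - b) - (c - d) \<in> \<int>" by (rule Ints_diff)
  then show "infdist (a - c) \<int> = infdist (b - d) \<int>"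
    by (intro infdist_Ints_cong) (simp add: algebra_simps)
qed

definition uniformity_circle :: "(circle \<times> circle) filter" where
  "uniformity_circle = (INF e\<in>{0<..}. principal {(x, y). dist x y < e})"

definition open_circle :: "circle set \<Rightarrow> bool" where
  "open_circle U \<longleftrightarrow> (\<forall>x\<in>U. eventually (\<lambda>(x', y). x' = x \<longrightarrow> y \<in> U) uniformity)"

instance
proof
  fix x y z :: circle
  have "infdist r \<int> = 0 \<longleftrightarrow> r \<in> \<int>" for r :: real
    using in_closed_iff_infdist_zero[OF closed_Ints, of r] by auto
  then show "dist x y = 0 \<longleftrightarrow> x = y"
    by transfer auto
  show "dist x y \<le> dist x z + dist y z"
  proof transfer
    fix x y z :: real
    show "infdist (x - y) \<int> \<le> infdist (x - z) \<int> + infdist (y - z) \<int>"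
      using infdist_Ints_add[of "x - z" "z - y"] infdist_Ints_uminus[of "y - z"] by simp
  qed
qed (simp_all add: uniformity_circle_def open_circle_def)

end

lemma dist_to_circle: "dist (to_circle x) (to_circle y) = infdist (x - y) \<int>"
  by transfer simp

lemma dist_to_circle_le: "dist (to_circle x) (to_circle y) \<le> dist x y"
  using infdist_le[of 0 \<int> "x - y"] by (simp add: dist_to_circle dist_real_def)

lemma dist_circle_add: "dist (a + b) (c + d) \<le> dist a c + dist b (d :: circle)"
  by transfer (metis add_diff_add infdist_Ints_add)

lemma dist_circle_minus: "dist (- a) (- b) = dist a (b :: circle)"
  by transfer (metis infdist_Ints_uminus minus_diff_minus)

lemma continuous_on_to_circle: "continuous_on X to_circle"
  using dist_to_circle_le unfolding continuous_on_iff by (metis order_le_less_trans)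

lemma range_to_circle: "to_circle ` {0..1} = UNIV"
proof -
  have "c \<in> to_circle ` {0..1}" for c
  proof -
    obtain x where "c = to_circle x"
      by (metis Quotient3_abs_rep Quotient3_circle)
    moreover have "to_circle x = to_circle (frac x)"
      unfolding circle.abs_eq_iff by (simp add: frac_def)
    ultimately show ?thesis
      using frac_ge_0[of x] frac_lt_1[of x] by auto
  qed
  then show ?thesis by auto
qed

lemma compact_UNIV_circle: "compact (UNIV :: circle set)"
  using compact_continuous_image[OF continuous_on_to_circle compact_Icc, of 0 1]
  by (simp add: range_to_circle)

lemma quotient_map_to_circle: "quotient_map euclidean euclidean to_circle"
proof (rule continuous_open_imp_quotient_map)
  show "continuous_map euclidean euclidean to_circle"
    by (simp add: continuous_on_to_circle)
  show "open_map euclidean euclidean to_circle"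
    unfolding open_map_def
  proof (intro allI impI)
    fix V :: "real set" assume "openin euclidean V"
    then have V: "open V" by simp
    have "\<exists>e>0. ball c e \<subseteq> to_circle ` V" if "c \<in> to_circle ` V" for c
    proof -
      obtain x where x: "x \<in> V" "c = to_circle x" using \<open>c \<in> to_circle ` V\<close> by auto
      obtain e where e: "e > 0" "ball x e \<subseteq> V" using V x openE by blast
      have *: "to_circle y \<in> to_circle ` V" if "infdist (x - y) \<int> < e" for y
      proof -
        have "(\<int> :: real set) \<noteq> {}" by auto
        then obtain k where k: "k \<in> \<int>" "infdist (x - y) \<int> = dist (x - y) k"
          using infdist_attains_inf[OF closed_Ints] by blast
        then have "y + k \<in> ball x e" using that by (simp add: dist_real_def algebra_simps)
        moreover have "to_circle y = to_circle (y + k)"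
          unfolding circle.abs_eq_iff using k by simp
        ultimately show ?thesis using e by auto
      qed
      have "ball c e \<subseteq> to_circle ` V"
      proof (intro subsetI)
        fix d assume d: "d \<in> ball c e"
        obtain y where y: "d = to_circle y" using range_to_circle by blast
        show "d \<in> to_circle ` V"
          using d *[of y] unfolding x(2) y by (simp add: dist_to_circle)
      qed
      then show ?thesis using e by blast
    qed
    then show "openin euclidean (to_circle ` V)"
      by (simp add: open_contains_ball)
  qed
  show "to_circle ` topspace euclidean = topspace euclidean"
    using range_to_circle by auto
qed

section \<open>The skew product\<close>

definition real_analytic :: "(real \<Rightarrow> real) \<Rightarrow> bool" where
  "real_analytic f \<longleftrightarrow>
     (\<forall>x. \<exists>r>0. \<exists>a. \<forall>y. \<bar>y - x\<bar> < r \<longrightarrow> (\<lambda>n. a n * (y - x) ^ n) sums f y)"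

definition circle_real_analytic :: "(circle \<Rightarrow> real) \<Rightarrow> bool" where
  "circle_real_analytic \<tau> \<longleftrightarrow> real_analytic (\<lambda>x. \<tau> (to_circle x))"

definition skew_map :: "real \<Rightarrow> (circle \<Rightarrow> real) \<Rightarrow> circle \<times> real \<Rightarrow> circle \<times> real" where
  "skew_map l \<tau> = (\<lambda>(\<theta>, t). (\<theta> + \<theta>, l * t + \<tau> \<theta>))"

definition nonwandering_set :: "('a :: topological_space \<Rightarrow> 'a) \<Rightarrow> 'a set" where
  "nonwandering_set f =
     {x. \<forall>V. open V \<and> x \<in> V \<longrightarrow> (\<exists>n\<ge>1. (f ^^ n) ` V \<inter> V \<noteq> {})}"

definition topological_annulus :: "'a :: topological_space set \<Rightarrow> bool" where
  "topological_annulus S \<longleftrightarrow> S homeomorphic ((UNIV :: circle set) \<times> {0..1 :: real})"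

section \<open>Spaces of Lipschitz maps\<close>

text \<open>Maps defined on \<open>K\<close> are represented by functions that are \<open>undefined\<close> off \<open>K\<close>.\<close>

definition Lip :: "(circle \<times> real) set \<Rightarrow> (circle \<times> real \<Rightarrow> circle \<times> real) set" where
  "Lip K = {F \<in> extensional K. \<exists>L. L-lipschitz_on K F}"

definition lip_const :: "'a :: metric_space set \<Rightarrow> ('a \<Rightarrow> 'b :: metric_space) \<Rightarrow> real" where
  "lip_const K h = Inf {L. L-lipschitz_on K h}"

text \<open>Differences of first components are taken in the group \<open>\<real>/\<int>\<close>; the sup norm of
  \<open>F - G\<close> is the supremum of the pointwise distances, the metric on \<open>\<real>/\<int> \<times> \<real>\<close> being
  translation invariant.  The locale \<open>Metric_space\<close> wants non-negativity also off the carrier, hence the value 0 there.\<close>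

definition dist_L ::
  "(circle \<times> real) set \<Rightarrow> (circle \<times> real \<Rightarrow> circle \<times> real) \<Rightarrow> (circle \<times> real \<Rightarrow> circle \<times> real) \<Rightarrow> real"
  where
  "dist_L K F G =
     (if F \<in> Lip K \<and> G \<in> Lip K
      then (SUP p\<in>K. dist (F p) (G p))
           + lip_const K (\<lambda>p. fst (F p) - fst (G p))
           + lip_const K (\<lambda>p. snd (F p) - snd (G p))
      else 0)"

definition Lip_into :: "(circle \<times> real) set \<Rightarrow> (circle \<times> real \<Rightarrow> circle \<times> real) set" where
  "Lip_into U = {F \<in> Lip (closure U). F ` closure U \<subseteq> U}"

definition Lip_into_topology :: "(circle \<times> real) set \<Rightarrow> (circle \<times> real \<Rightarrow> circle \<times> real) topology" where
  "Lip_into_topology U =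
     subtopology (Metric_space.mtopology (Lip (closure U)) (dist_L (closure U))) (Lip_into U)"

definition attractor :: "(circle \<times> real) set \<Rightarrow> (circle \<times> real \<Rightarrow> circle \<times> real) \<Rightarrow> (circle \<times> real) set" where
  "attractor U F = (\<Inter>n. (F ^^ n) ` closure U)"

lemma lip_const_nonneg: "L-lipschitz_on K h \<Longrightarrow> 0 \<le> lip_const K h"
  unfolding lip_const_def by (rule cInf_greatest) (auto dest: lipschitz_on_nonneg)

lemma lip_const_le: "L-lipschitz_on K h \<Longrightarrow> lip_const K h \<le> L"
  unfolding lip_const_def
  by (rule cInf_lower) (auto intro!: bdd_belowI[of _ 0] dest: lipschitz_on_nonneg)

lemma lip_const_lipschitz:
  assumes "L-lipschitz_on K h"
  shows "(lip_const K h)-lipschitz_on K h"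
proof (rule lipschitz_onI)
  show "0 \<le> lip_const K h" using assms by (rule lip_const_nonneg)
  fix x y assume xy: "x \<in> K" "y \<in> K"
  show "dist (h x) (h y) \<le> lip_const K h * dist x y"
  proof (cases "x = y")
    case False
    have "dist (h x) (h y) / dist x y \<le> lip_const K h"
      unfolding lip_const_def
    proof (rule cInf_greatest)
      fix M assume "M \<in> {L. L-lipschitz_on K h}"
      then have "dist (h x) (h y) \<le> M * dist x y"
        using xy by (auto dest: lipschitz_onD)
      then show "dist (h x) (h y) / dist x y \<le> M"
        using False by (simp add: pos_divide_le_eq)
    qed (use assms in auto)
    then show ?thesis using False by (simp add: pos_divide_le_eq)
  qed auto
qed

lemma lip_const_eq_0: "(\<And>p. p \<in> K \<Longrightarrow> h p = c) \<Longrightarrow> lip_const K h = 0"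
proof -
  assume "\<And>p. p \<in> K \<Longrightarrow> h p = c"
  then have "0-lipschitz_on K h" by (simp add: lipschitz_on_def)
  then show ?thesis by (metis lip_const_le lip_const_nonneg order_antisym)
qed

lemma Lip_components:
  assumes "F \<in> Lip K"
  shows "\<exists>L. L-lipschitz_on K (\<lambda>p. fst (F p))" "\<exists>L. L-lipschitz_on K (\<lambda>p. snd (F p))"
proof -
  obtain L where L: "L-lipschitz_on K F" using assms by (auto simp: Lip_def)
  have "L-lipschitz_on K (\<lambda>p. fst (F p))" "L-lipschitz_on K (\<lambda>p. snd (F p))"
    using L unfolding lipschitz_on_def
    by (auto intro: order_trans[OF dist_fst_le] order_trans[OF dist_snd_le])
  then show "\<exists>L. L-lipschitz_on K (\<lambda>p. fst (F p))" "\<exists>L. L-lipschitz_on K (\<lambda>p. snd (F p))"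
    by blast+
qed

lemma dist_diff_le_circle: "dist (a - b) (c - d) \<le> dist a c + dist b (d :: circle)"
  using dist_circle_add[of a "- b" c "- d"] by (simp add: dist_circle_minus)

lemma dist_diff_le_real: "dist (a - b) (c - d) \<le> dist a c + dist b (d :: real)"
  by (simp add: dist_real_def)

lemma lipschitz_on_sum:
  assumes "L-lipschitz_on K f" "M-lipschitz_on K g"
    and "\<And>x y. dist (h x) (h y) \<le> dist (f x) (f y) + dist (g x) (g y)"
  shows "(L + M)-lipschitz_on K h"
proof (rule lipschitz_onI)
  show "0 \<le> L + M" using assms by (simp add: lipschitz_on_def)
  fix x y assume xy: "x \<in> K" "y \<in> K"
  have "dist (h x) (h y) \<le> dist (f x) (f y) + dist (g x) (g y)" by (rule assms)
  also have "\<dots> \<le> L * dist x y + M * dist x y"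
    using assms xy by (intro add_mono) (auto dest: lipschitz_onD)
  finally show "dist (h x) (h y) \<le> (L + M) * dist x y" by (simp add: distrib_right)
qed

lemma Lip_diff:
  assumes "F \<in> Lip K" "G \<in> Lip K"
  shows "\<exists>L. L-lipschitz_on K (\<lambda>p. fst (F p) - fst (G p))"
    and "\<exists>L. L-lipschitz_on K (\<lambda>p. snd (F p) - snd (G p))"
proof -
  obtain L1 L2 M1 M2 where
    "L1-lipschitz_on K (\<lambda>p. fst (F p))" "L2-lipschitz_on K (\<lambda>p. snd (F p))"
    "M1-lipschitz_on K (\<lambda>p. fst (G p))" "M2-lipschitz_on K (\<lambda>p. snd (G p))"
    using Lip_components assms by meson
  then have "(L1 + M1)-lipschitz_on K (\<lambda>p. fst (F p) - fst (G p))"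
    "(L2 + M2)-lipschitz_on K (\<lambda>p. snd (F p) - snd (G p))"
    by (auto intro: lipschitz_on_sum dist_diff_le_circle dist_diff_le_real)
  then show "\<exists>L. L-lipschitz_on K (\<lambda>p. fst (F p) - fst (G p))"
    "\<exists>L. L-lipschitz_on K (\<lambda>p. snd (F p) - snd (G p))" by blast+
qed

lemma lip_const_sum:
  assumes "\<exists>L. L-lipschitz_on K f" "\<exists>L. L-lipschitz_on K g"
    and "\<And>x y. dist (h x) (h y) \<le> dist (f x) (f y) + dist (g x) (g y)"
  shows "lip_const K h \<le> lip_const K f + lip_const K g"
proof -
  have "(lip_const K f + lip_const K g)-lipschitz_on K h"
    using assms by (auto intro: lipschitz_on_sum lip_const_lipschitz)
  then show ?thesis by (rule lip_const_le)
qed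

lemma lip_const_sym:
  assumes "\<And>x y. dist (h x) (h y) = dist (f x) (f y)"
  shows "lip_const K h = lip_const K f"
  unfolding lip_const_def lipschitz_on_def by (simp add: assms)

lemma Lip_bdd_above:
  assumes "compact K" "F \<in> Lip K" "G \<in> Lip K"
  shows "bdd_above ((\<lambda>p. dist (F p) (G p)) ` K)"
proof -
  have "continuous_on K F" "continuous_on K G"
    using assms by (auto simp: Lip_def intro: lipschitz_on_continuous_on)
  then have "compact ((\<lambda>p. dist (F p) (G p)) ` K)"
    using assms by (intro compact_continuous_image continuous_intros)
  then show ?thesis by (simp add: bounded_imp_bdd_above compact_imp_bounded)
qed

lemma Metric_space_Lip:
  assumes K: "compact K" "K \<noteq> {}"
  shows "Metric_space (Lip K) (dist_L K)"
proof -
  have Lnn: "\<exists>L. L-lipschitz_on K h \<Longrightarrow> 0 \<le> lip_const K h"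
      "\<exists>L. L-lipschitz_on K h' \<Longrightarrow> 0 \<le> lip_const K h'"
    for h :: "circle \<times> real \<Rightarrow> circle" and h' :: "circle \<times> real \<Rightarrow> real"
    using lip_const_nonneg by blast+
  obtain p0 where p0: "p0 \<in> K" using K by auto
  have sup: "dist (F p) (G p) \<le> (SUP p\<in>K. dist (F p) (G p))"
    if "F \<in> Lip K" "G \<in> Lip K" "p \<in> K" for F G p
    using that Lip_bdd_above[OF K(1) that(1,2)] by (rule_tac cSUP_upper) auto
  have sup0: "0 \<le> (SUP p\<in>K. dist (F p) (G p))" if "F \<in> Lip K" "G \<in> Lip K" for F G
    using sup[OF that p0] zero_le_dist order_trans by blast
  have sym: "dist_L K F G = dist_L K G F" for F G
  proof -
    have "dist (a - b) (c - d) = dist (b - a) (d - c)" for a b c d :: circle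
      using dist_circle_minus[of "a - b" "c - d"] by simp
    then have "lip_const K (\<lambda>p. fst (F p) - fst (G p)) = lip_const K (\<lambda>p. fst (G p) - fst (F p))"
      by (intro lip_const_sym)
    moreover have "dist (a - b) (c - d) = dist (b - a) (d - c)" for a b c d :: real
      by (simp add: dist_real_def abs_if)
    then have "lip_const K (\<lambda>p. snd (F p) - snd (G p)) = lip_const K (\<lambda>p. snd (G p) - snd (F p))"
      by (intro lip_const_sym)
    ultimately show ?thesis by (simp add: dist_L_def dist_commute)
  qed
  have zero: "dist_L K F G = 0 \<longleftrightarrow> F = G" if FG: "F \<in> Lip K" "G \<in> Lip K" for F G
  proof
    assume "dist_L K F G = 0"
    then have "(SUP p\<in>K. dist (F p) (G p)) \<le> 0"
      using Lnn(1)[OF Lip_diff(1)[OF FG]] Lnn(2)[OF Lip_diff(2)[OF FG]] FG by (simp add: dist_L_def)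
    then have "F p = G p" if "p \<in> K" for p
      using sup[OF FG that] by (metis dist_le_zero_iff order_trans)
    then show "F = G" using FG by (auto simp: Lip_def intro: extensionalityI)
  next
    assume "F = G"
    then show "dist_L K F G = 0"
      using K FG by (simp add: dist_L_def lip_const_eq_0[of K _ 0])
  qed
  have tri: "dist_L K F H \<le> dist_L K F G + dist_L K G H"
    if FGH: "F \<in> Lip K" "G \<in> Lip K" "H \<in> Lip K" for F G H
  proof -
    have "(SUP p\<in>K. dist (F p) (H p)) \<le> (SUP p\<in>K. dist (F p) (G p)) + (SUP p\<in>K. dist (G p) (H p))"
    proof (rule cSUP_least[OF K(2)])
      fix p assume p: "p \<in> K"
      show "dist (F p) (H p) \<le> (SUP p\<in>K. dist (F p) (G p)) + (SUP p\<in>K. dist (G p) (H p))"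
        by (rule order_trans[OF dist_triangle add_mono[OF sup[OF FGH(1,2) p] sup[OF FGH(2,3) p]]])
    qed
    moreover have "dist (a - c) (a' - c') \<le> dist (a - b) (a' - b') + dist (b - c) (b' - c')"
      for a b c a' b' c' :: circle
      using dist_circle_add[of "a - b" "b - c" "a' - b'" "b' - c'"] by simp
    then have "lip_const K (\<lambda>p. fst (F p) - fst (H p))
      \<le> lip_const K (\<lambda>p. fst (F p) - fst (G p)) + lip_const K (\<lambda>p. fst (G p) - fst (H p))"
      by (intro lip_const_sum Lip_diff FGH)
    moreover have "dist (a - c) (a' - c') \<le> dist (a - b) (a' - b') + dist (b - c) (b' - c')"
      for a b c a' b' c' :: real
      by (simp add: dist_real_def)
    then have "lip_const K (\<lambda>p. snd (F p) - snd (H p))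
      \<le> lip_const K (\<lambda>p. snd (F p) - snd (G p)) + lip_const K (\<lambda>p. snd (G p) - snd (H p))"
      by (intro lip_const_sum Lip_diff FGH)
    ultimately show ?thesis using FGH by (simp add: dist_L_def)
  qed
  show ?thesis
  proof
    show "0 \<le> dist_L K F G" for F G
      using Lnn(1)[OF Lip_diff(1)] Lnn(2)[OF Lip_diff(2)] sup0 by (simp add: dist_L_def)
  qed (use sym zero tri in auto)
qed

lemma topspace_Lip_into_topology:
  assumes "compact (closure U)" "U \<noteq> {}"
  shows "topspace (Lip_into_topology U) = Lip_into U"
proof -
  interpret Metric_space "Lip (closure U)" "dist_L (closure U)"
    using assms by (intro Metric_space_Lip) auto
  show ?thesis by (auto simp: Lip_into_topology_def Lip_into_def)
qed

end

theory Submission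
  imports Defs "HOL-Complex_Analysis.Complex_Analysis"
begin

text \<open>
  Choose \<open>\<tau>\<close> so that \<open>W = {(\<theta>, t). \<bar>t\<bar> \<le> \<Lambda> (dist \<theta> 0)}\<close> is covered by its own image with a margin;
  by Brouwer's theorem every \<open>F\<close> uniformly close to \<open>A\<close> then satisfies \<open>W \<subseteq> F W\<close>, so \<open>W \<subseteq> \<Omega>\<^sub>F\<close>.
  Over \<open>\<theta>\<close> two intervals of radii \<open>l \<Lambda> (y)\<close> and \<open>l \<Lambda> (y + 1 / 2)\<close>, \<open>2 y = \<theta>\<close>, have to cover one of radius
  \<open>\<Lambda> (\<theta>)\<close>, which is possible with room to spare as \<open>2 l > 1\<close>, except that their order is
  reversed when \<open>\<theta>\<close> goes once around the circle. They cross over \<open>\<theta> = 1 / 2\<close>, where \<open>\<Lambda>\<close> is so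
  small that either interval alone suffices; the dip of \<open>\<Lambda>\<close> at \<open>1 / 2\<close> is absorbed by a slowly
  decaying dip around the fixed point \<open>0\<close>.

  Since the branch through \<open>3 / 4\<close> alone covers \<open>W\<close> over \<open>1 / 2\<close>, a high narrow bump can be
  added to \<open>\<tau>\<close> at \<open>1 / 4\<close>. The image of the zero section then contains an arch over \<open>W\<close>.
  The points under it are not in the attractor, because backward orbits of \<open>1 / 4\<close> and
  \<open>3 / 4\<close> stay away from the bump for a long time. Hence the complement of the attractor has at least
  three components, whereas the complement of an annulus in the cylinder has only two,
  by invariance of domain and the theorems of Jordan and Janiszewski.
  These properties survive small uniform perturbations, so \<open>\<tau>\<close> may be replaced by a trigonometric polynomial.
\<close>

section \<open>The circle\<close>

lemma to_circle_eq_iff: "to_circle x = to_circle y \<longleftrightarrow> x - y \<in> \<int>"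
  by (rule circle.abs_eq_iff)

lemma to_circle_add: "to_circle x + to_circle y = to_circle (x + y)"
  by (rule plus_circle.abs_eq)

lemma zero_circle_eq: "0 = to_circle 0"
  by (simp add: zero_circle_def)

lemma dist_circle_diff: "dist a b = dist (a - b) (0 :: circle)"
  by transfer simp

lemma dist_circle_cancel_left: "dist (a + b) (a + c) = dist b (c :: circle)"
  by transfer simp

lemma infdist_Ints_eq_abs:
  assumes "\<bar>x\<bar> \<le> 1 / 2"
  shows "infdist x \<int> = \<bar>x :: real\<bar>"
proof (rule antisym)
  show "infdist x \<int> \<le> \<bar>x\<bar>"
    using infdist_le[of 0 \<int> x] by simp
  have "\<bar>x\<bar> \<le> dist x k" if "k \<in> \<int>" for k
  proof (cases "k = 0")
    case False
    then have "1 \<le> \<bar>k\<bar>" using that Ints_nonzero_abs_ge1 by blast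
    then show ?thesis using assms by (simp add: dist_real_def)
  qed simp
  then show "\<bar>x\<bar> \<le> infdist x \<int>"
    by (subst infdist_notempty) (auto intro!: cINF_greatest)
qed

lemma dist_to_circle_eq:
  assumes "\<bar>x - y\<bar> \<le> 1 / 2"
  shows "dist (to_circle x) (to_circle y) = \<bar>x - y\<bar>"
  using infdist_Ints_eq_abs[OF assms] by (simp add: dist_to_circle)

lemma to_circle_nearest:
  obtains x where "c = to_circle x" "\<bar>x\<bar> = dist c 0" "\<bar>x\<bar> \<le> 1 / 2"
proof -
  obtain x0 where x0: "c = to_circle x0" using range_to_circle by blast
  define x where "x = x0 - of_int (round x0)"
  have le: "\<bar>x\<bar> \<le> 1 / 2"
    unfolding x_def using of_int_round_abs_le[of x0] by (simp add: abs_minus_commute)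
  have "c = to_circle x" unfolding x0 x_def to_circle_eq_iff by simp
  moreover have "\<bar>x\<bar> = dist c 0"
    using le dist_to_circle_eq[of x 0] by (simp add: calculation zero_circle_eq)
  ultimately show ?thesis using le that by blast
qed

lemma dist_circle_le_half: "dist a (b :: circle) \<le> 1 / 2"
  using to_circle_nearest[of "a - b"] dist_circle_diff[of a b] by metis

text \<open>On distances to 0, doubling acts as the tent map. The fibre radius depends on
  \<open>dist y 0\<close> alone, so covering becomes a question about this map.\<close>

lemma dist_circle_double:
  "dist (y + y) 0 = (if dist y 0 \<le> 1 / 4 then 2 * dist y 0 else 1 - 2 * dist y (0 :: circle))"
proof -
  obtain x where x: "y = to_circle x" "\<bar>x\<bar> = dist y 0" "\<bar>x\<bar> \<le> 1 / 2"
    by (rule to_circle_nearest)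
  have yy: "y + y = to_circle (2 * x)" by (simp add: x to_circle_add)
  consider "\<bar>x\<bar> \<le> 1 / 4" | "x > 1 / 4" | "x < - 1 / 4" by linarith
  then show ?thesis
  proof cases
    case 1
    then show ?thesis
      using dist_to_circle_eq[of "2 * x" 0] x(2) yy by (simp add: zero_circle_eq)
  next
    case 2
    have "to_circle (2 * x) = to_circle (2 * x - 1)" by (simp add: to_circle_eq_iff)
    then show ?thesis
      using dist_to_circle_eq[of "2 * x - 1" 0] 2 x(2,3) yy by (simp add: zero_circle_eq)
  next
    case 3
    have "to_circle (2 * x) = to_circle (2 * x + 1)" by (simp add: to_circle_eq_iff)
    then show ?thesis
      using dist_to_circle_eq[of "2 * x + 1" 0] 3 x(2,3) yy by (simp add: zero_circle_eq)
  qed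
qed

text \<open>Adding 1/2 passes to the other preimage under doubling; hence the pairing of
  \<open>v\<close> with \<open>1 / 2 - v\<close> in the covering inequalities.\<close>

lemma dist_circle_antipode: "dist (y + to_circle (1 / 2)) 0 = 1 / 2 - dist y 0"
proof -
  obtain x where x: "y = to_circle x" "\<bar>x\<bar> = dist y 0" "\<bar>x\<bar> \<le> 1 / 2"
    by (rule to_circle_nearest)
  show ?thesis
  proof (cases "x \<ge> 0")
    case True
    have "y + to_circle (1 / 2) = to_circle (x - 1 / 2)"
      by (simp add: x to_circle_add to_circle_eq_iff)
    then show ?thesis
      using dist_to_circle_eq[of "x - 1 / 2" 0] True x(2,3) by (simp add: zero_circle_eq)
  next
    case False
    then show ?thesis
      using dist_to_circle_eq[of "x + 1 / 2" 0] x by (simp add: zero_circle_eq to_circle_add)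
  qed
qed

lemma circle_halves:
  obtains y :: circle where "\<theta> = y + y" "dist y 0 \<le> 1 / 4"
proof -
  obtain x where x: "\<theta> = to_circle x" "\<bar>x\<bar> \<le> 1 / 2" by (rule to_circle_nearest) auto
  show ?thesis
  proof
    show "\<theta> = to_circle (x / 2) + to_circle (x / 2)" by (simp add: x to_circle_add)
    show "dist (to_circle (x / 2)) 0 \<le> 1 / 4"
      using x(2) dist_to_circle_eq[of "x / 2" 0] by (simp add: zero_circle_eq)
  qed
qed

lemma antipode_double:
  "(y + to_circle (1 / 2)) + (y + to_circle (1 / 2)) = y + y"
proof -
  have "to_circle (1 / 2) + to_circle (1 / 2) = 0"
    by (simp add: to_circle_add zero_circle_eq to_circle_eq_iff)
  then show ?thesis by (metis add.assoc add.commute add.right_neutral)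
qed

section \<open>The circle as the unit circle in the complex plane\<close>

lift_definition circle_cis :: "circle \<Rightarrow> complex" is "\<lambda>x. cis (2 * pi * x)"
proof -
  fix x y :: real
  assume "x - y \<in> \<int>"
  then obtain k where "x = y + of_int k" by (metis Ints_cases add.commute diff_add_cancel)
  then show "cis (2 * pi * x) = cis (2 * pi * y)"
    using cis_multiple_2pi[of "of_int k"] by (simp add: distrib_left cis_mult[symmetric])
qed

lemma circle_cis_to_circle: "circle_cis (to_circle x) = cis (2 * pi * x)"
  by (rule circle_cis.abs_eq)

lemma norm_circle_cis [simp]: "norm (circle_cis c) = 1"
  by transfer simp

text \<open>The universal property of the quotient topology.\<close>

lemma continuous_on_circle_iff:
  "continuous_on UNIV f \<longleftrightarrow> continuous_on UNIV (\<lambda>x. f (to_circle x))"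
  for f :: "circle \<Rightarrow> 'a :: topological_space"
  using quotient_map_to_circle continuous_map_compose continuous_compose_quotient_map
  by (metis (no_types, lifting) comp_apply continuous_map_iff_continuous2 
      continuous_on_cong quotient_imp_continuous_map)

lemma continuous_on_circle_cis: "continuous_on X circle_cis"
proof -
  have "continuous_on UNIV circle_cis"
    unfolding continuous_on_circle_iff circle_cis_to_circle by (intro continuous_intros)
  then show ?thesis using continuous_on_subset by blast
qed

lemma inj_circle_cis: "inj circle_cis"
proof (rule injI)
  fix a b assume eq: "circle_cis a = circle_cis b"
  obtain x y where xy: "a = to_circle x" "b = to_circle y" using range_to_circle by blast
  have "cis (2 * pi * x) = cis (2 * pi * y)" using eq by (simp add: xy circle_cis_to_circle)
  then obtain k where "2 * pi * x = 2 * pi * y + 2 * pi * of_int k"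
    using sin_cos_eq_iff[of "2 * pi * x" "2 * pi * y"] by (auto simp: complex_eq_iff)
  then have "2 * pi * (x - y) = 2 * pi * of_int k" by (simp add: algebra_simps)
  then have "x - y = of_int k" by simp
  then show "a = b" by (simp add: xy to_circle_eq_iff)
qed

lemma range_circle_cis: "range circle_cis = sphere 0 1"
proof -
  have "z \<in> range circle_cis" if "norm z = 1" for z
  proof -
    have "z = circle_cis (to_circle (Arg z / (2 * pi)))"
      using that cis_Arg[of z] by (cases "z = 0") (auto simp: circle_cis_to_circle sgn_eq)
    then show ?thesis by blast
  qed
  then show ?thesis by auto
qed

lemma circle_cis_homeomorphism:
  obtains h where "homeomorphism UNIV (sphere 0 1) circle_cis h"
  using homeomorphism_compact[OF compact_UNIV_circle continuous_on_circle_cis range_circle_cis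
      inj_circle_cis] by blast

section \<open>Annuli in the cylinder\<close>

text \<open>Logarithmic polar coordinates. They turn the cylinder into the punctured plane, where
  the theorems of Jordan and Janiszewski apply.\<close>

lemma cylinder_homeomorphism:
  obtains g where
    "homeomorphism UNIV (- {0}) (\<lambda>(c, t). of_real (exp t) * circle_cis c) g"
proof -
  obtain h where h: "homeomorphism UNIV (sphere 0 1) circle_cis h"
    by (rule circle_cis_homeomorphism)
  then have h1: "continuous_on (sphere 0 1) h" "\<And>c. h (circle_cis c) = c"
      "\<And>z. z \<in> sphere 0 1 \<Longrightarrow> circle_cis (h z) = z"
    by (auto simp: homeomorphism_def)
  define g where "g = (\<lambda>z :: complex. (h (z / of_real (norm z)), ln (norm z)))"
  have "homeomorphism UNIV (- {0}) (\<lambda>(c, t). of_real (exp t) * circle_cis c) g"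
    unfolding homeomorphism_def
  proof (intro conjI)
    let ?f = "\<lambda>(c :: circle, t :: real). of_real (exp t) * circle_cis c"
    show "\<forall>x\<in>UNIV. g (?f x) = x"
      by (auto simp: g_def norm_mult h1)
    show fg: "\<forall>y\<in>- {0}. ?f (g y) = y"
      by (auto simp: g_def h1 norm_divide)
    show "continuous_on UNIV ?f"
      unfolding split_beta
      by (intro continuous_intros continuous_on_compose2[OF continuous_on_circle_cis[of UNIV]]) auto
    show "continuous_on (- {0}) g"
      unfolding g_def
      by (intro continuous_intros continuous_on_compose2[OF h1(1)])
        (auto simp: norm_divide split: if_splits)
    have nz: "?f p \<noteq> 0" for p
      by (auto simp: split_beta) (metis norm_circle_cis norm_zero zero_neq_one)
    show "range ?f = - {0}"
    proof (intro equalityI subsetI)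
      fix z :: complex assume "z \<in> - {0}"
      then show "z \<in> range ?f" using fg by (metis rangeI)
    qed (use nz in auto)
    show "g ` (- {0}) = UNIV"
    proof (intro equalityI subsetI)
      fix p
      have "p = g (?f p)" by (cases p) (auto simp: g_def norm_mult h1)
      then show "p \<in> g ` (- {0})" using nz[of p] by blast
    qed auto
  qed
  then show ?thesis by (rule that)
qed

lemma connected_UNIV_circle: "connected (UNIV :: circle set)"
  using connected_continuous_image[OF continuous_on_to_circle connected_Icc, of 0 1]
  by (simp add: range_to_circle)

text \<open>Names the sides of a Jordan curve by the position of \<open>K\<close> and not by
  boundedness, because either boundary curve of an annulus may be the outer one.\<close>

lemma Jordan_side:
  assumes "simple_path c" "pathfinish c = pathstart c"
    and "connected K" "K \<inter> path_image c = {}"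
  obtains X Y :: "complex set" where "open X" "connected X" "open Y" "connected Y"
    "X \<inter> Y = {}" "X \<union> Y = - path_image c" "K \<subseteq> Y"
proof -
  let ?I = "inside (path_image c)" and ?O = "outside (path_image c)"
  have J: "open ?I" "connected ?I" "open ?O" "connected ?O" "?I \<inter> ?O = {}"
      "?I \<union> ?O = - path_image c"
    using Jordan_inside_outside[OF assms(1,2)] by auto
  have "?I \<inter> K = {} \<or> ?O \<inter> K = {}"
    by (rule connectedD[OF assms(3) J(1,3)]) (use J(5,6) assms(4) in auto)
  then consider "K \<subseteq> ?I" | "K \<subseteq> ?O" using J(6) assms(4) by blast
  then show ?thesis
  proof cases
    case 1
    then show ?thesis using J by (intro that[of ?O ?I]) (simp_all add: Un_commute Int_commute)
  next
    case 2
    then show ?thesis using J by (intro that[of ?I ?O]) simp_all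
  qed
qed

text \<open>Each boundary curve has a side \<open>Y\<close> that contains the rest of the annulus
  and another side \<open>X\<close>. A point outside the annulus lies in one of the two sets
  \<open>X\<close>: otherwise neither curve separates it from the interior of the annulus, so by
  Janiszewski's theorem their union does not either, although this union bounds the
  interior.\<close>

lemma plane_annulus_complement:
  fixes S :: "complex set"
  assumes "topological_annulus S"
  obtains X1 X2 where "open X1" "connected X1" "open X2" "connected X2" "- S = X1 \<union> X2"
proof -
  let ?A = "(UNIV :: circle set) \<times> {0..1 :: real}"
  have "?A homeomorphic S"
    using assms unfolding topological_annulus_def by (rule homeomorphic_sym[THEN iffD1])
  then obtain \<phi> \<psi> where hom: "homeomorphism ?A S \<phi> \<psi>"
    unfolding homeomorphic_def by (elim exE)
  have cont: "continuous_on ?A \<phi>" and img: "\<phi> ` ?A = S"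
    by (rule homeomorphism_cont1[OF hom], rule homeomorphism_image1[OF hom])
  have inj: "inj_on \<phi> ?A"
    using homeomorphism_apply1[OF hom] by (rule inj_on_inverseI)
  have compS: "compact S"
    using compact_continuous_image[OF cont] compact_UNIV_circle img
    by (simp add: compact_Times)
  define C where "C k = \<phi> ` (UNIV \<times> {k})" for k
  define I where "I = \<phi> ` (UNIV \<times> {0<..<1})"
  have curve: "\<exists>c. simple_path c \<and> pathfinish c = pathstart c \<and> path_image c = C k"
    if k: "k \<in> {0..1}" for k
  proof (intro exI conjI)
    let ?c = "\<lambda>t. \<phi> (to_circle t, k)"
    show "pathfinish ?c = pathstart ?c"
      using to_circle_eq_iff[of 1 0] by (simp add: pathfinish_def pathstart_def)
    show "path_image ?c = C k"
    proof -
      have "path_image ?c = \<phi> ` ((\<lambda>t. (to_circle t, k)) ` {0..1})"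
        by (simp add: path_image_def image_image)
      also have "(\<lambda>t. (to_circle t, k)) ` {0..1} = (to_circle ` {0..1}) \<times> {k}" by auto
      finally show ?thesis by (simp add: C_def range_to_circle)
    qed
    show "simple_path ?c"
      unfolding simple_path_def loop_free_def
    proof (intro conjI ballI impI)
      show "path ?c"
        unfolding path_def using k
        by (intro continuous_on_compose2[OF cont] continuous_intros continuous_on_to_circle) auto
      fix x y :: real assume xy: "x \<in> {0..1}" "y \<in> {0..1}" "?c x = ?c y"
      then have "(to_circle x, k) = (to_circle y, k)"
        using inj k by (meson SigmaI UNIV_I inj_onD)
      then have "x - y \<in> \<int>" by (simp add: to_circle_eq_iff)
      moreover have "-1 \<le> x - y" "x - y \<le> 1" using xy by auto
      ultimately obtain j where "x - y = of_int j" "- 1 \<le> j" "j \<le> 1"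
        by (auto elim!: Ints_cases)
      then have "x - y = -1 \<or> x - y = 0 \<or> x - y = 1" by force
      then show "x = y \<or> x = 0 \<and> y = 1 \<or> x = 1 \<and> y = 0" using xy by auto
    qed
  qed
  have SU: "S = I \<union> C 0 \<union> C 1"
    unfolding img[symmetric] I_def C_def image_Un[symmetric] by (rule arg_cong[of _ _ "image \<phi>"]) auto
  have disj: "I \<inter> C 0 = {}" "I \<inter> C 1 = {}" "C 0 \<inter> C 1 = {}"
    unfolding I_def C_def by (subst inj_on_image_Int[OF inj, symmetric]; auto)+
  have sub: "UNIV \<times> {0<..<1} \<subseteq> ?A" "UNIV \<times> {0<..1} \<subseteq> ?A" "UNIV \<times> {0..<1} \<subseteq> ?A" by auto
  have conn: "connected (\<phi> ` (UNIV \<times> J))" if "connected J" "UNIV \<times> J \<subseteq> ?A" for J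
    using that by (intro connected_continuous_image continuous_on_subset[OF cont] connected_Times
        connected_UNIV_circle)
  have "connected I" unfolding I_def using sub by (intro conn) auto
  have "\<phi> ` (UNIV \<times> {0<..1}) = I \<union> C 1" "\<phi> ` (UNIV \<times> {0..<1}) = I \<union> C 0"
    unfolding I_def C_def image_Un[symmetric] by (rule arg_cong[of _ _ "image \<phi>"]; auto)+
  moreover have "connected (\<phi> ` (UNIV \<times> {0<..1}))" "connected (\<phi> ` (UNIV \<times> {0..<1}))"
    by (intro conn connected_Ioc connected_Ico sub)+
  ultimately have conn01: "connected (I \<union> C 1)" "connected (I \<union> C 0)" by auto
  \<comment> \<open>The model annulus does not lie in the plane, so it is first carried to an open
    set of the plane; invariance of domain applies to the composite map.\<close>
  have "open I"
  proof -
    obtain g where g: "homeomorphism UNIV (- {0}) (\<lambda>(c, t). of_real (exp t) * circle_cis c) g"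
      by (rule cylinder_homeomorphism)
    define E :: "circle \<times> real \<Rightarrow> complex" where "E = (\<lambda>(c, t). of_real (exp t) * circle_cis c)"
    have "homeomorphism UNIV (- {0}) E g" using g by (simp add: E_def)
    then have E: "continuous_on (- {0}) g" "\<And>p. g (E p) = p"
        "\<And>z. z \<noteq> 0 \<Longrightarrow> E (g z) = z" "\<And>p. E p \<noteq> 0"
      unfolding homeomorphism_def by (blast+)
    let ?O = "{z \<in> - {0}. g z \<in> UNIV \<times> {0<..<1}}"
    have "open ?O"
      using continuous_open_preimage[OF E(1), of "UNIV \<times> {0<..<1}"]
      by (simp add: open_Times vimage_def Int_def open_Compl)
    moreover have "continuous_on ?O (\<lambda>z. \<phi> (g z))"
      by (intro continuous_on_compose2[OF cont] continuous_on_subset[OF E(1)]) auto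
    moreover have "inj_on (\<lambda>z. \<phi> (g z)) ?O"
    proof (rule inj_onI)
      fix z w assume zw: "z \<in> ?O" "w \<in> ?O" "\<phi> (g z) = \<phi> (g w)"
      have "g z \<in> ?A" "g w \<in> ?A" using zw(1,2) sub(1) by auto
      then have eq: "g z = g w" using inj_onD[OF inj zw(3)] by simp
      have nz: "z \<noteq> 0" "w \<noteq> 0" using zw(1,2) by auto
      show "z = w" using E(3)[OF nz(1)] E(3)[OF nz(2)] unfolding eq by (rule trans[OF sym])
    qed
    ultimately have "open ((\<lambda>z. \<phi> (g z)) ` ?O)" by (intro invariance_of_domain)
    moreover have "g ` ?O = UNIV \<times> {0<..<1}"
    proof (intro equalityI subsetI)
      fix p :: "circle \<times> real" assume p: "p \<in> UNIV \<times> {0<..<1}"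
      from E(4)[of p] p have "E p \<in> ?O" unfolding mem_Collect_eq E(2) by simp
      then show "p \<in> g ` ?O" by (rule rev_image_eqI) (simp only: E(2))
    qed auto
    then have "(\<lambda>z. \<phi> (g z)) ` ?O = I" unfolding I_def by (subst image_image[symmetric]) simp
    ultimately show ?thesis by simp
  qed
  obtain c0 where c0: "simple_path c0" "pathfinish c0 = pathstart c0" "path_image c0 = C 0"
    using curve[of 0] by (meson atLeastAtMost_iff order_refl zero_le_one)
  obtain c1 where c1: "simple_path c1" "pathfinish c1 = pathstart c1" "path_image c1 = C 1"
    using curve[of 1] by (meson atLeastAtMost_iff order_refl zero_le_one)
  obtain X0 Y0 where 0: "open X0" "connected X0" "open Y0" "connected Y0"
    "X0 \<inter> Y0 = {}" "X0 \<union> Y0 = - C 0" "I \<union> C 1 \<subseteq> Y0"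
    using Jordan_side[OF c0(1,2) conn01(1)] disj unfolding c0(3) by blast
  obtain X1 Y1 where 1: "open X1" "connected X1" "open Y1" "connected Y1"
    "X1 \<inter> Y1 = {}" "X1 \<union> Y1 = - C 1" "I \<union> C 0 \<subseteq> Y1"
    using Jordan_side[OF c1(1,2) conn01(2)] disj unfolding c1(3) by blast
  define a where "a = \<phi> (0, 1 / 2)"
  have a: "a \<in> I" unfolding I_def a_def by (intro imageI) simp
  have "b \<in> X0 \<union> X1" if b: "b \<in> - S" for b
  proof (rule ccontr)
    assume "b \<notin> X0 \<union> X1"
    then have bY: "b \<in> Y0" "b \<in> Y1" using 0 1 b SU by blast+
    have aY: "a \<in> Y0" "a \<in> Y1" using a 0 1 by auto
    have cmp: "compact (C 0)" "compact (C 1)"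
      using compact_simple_path_image c0 c1 by metis+
    have "connected_component (- C 0) a b" "connected_component (- C 1) a b"
      unfolding connected_component_def using 0 1 aY bY by blast+
    \<comment> \<open>Janiszewski's theorem asks for a connected intersection of the two compact
      sets; here it is empty.\<close>
    then have "connected_component (- (C 0 \<union> C 1)) a b"
      using cmp disj(3) by (intro Janiszewski) (auto intro: compact_imp_closed)
    then obtain D where D: "connected D" "D \<subseteq> - (C 0 \<union> C 1)" "a \<in> D" "b \<in> D"
      by (auto simp: connected_component_def)
    have "I \<inter> D = {} \<or> - S \<inter> D = {}"
    proof (rule connectedD[OF D(1) \<open>open I\<close>])
      show "open (- S)" using compS by (simp add: compact_imp_closed open_Compl)
    qed (use SU D(2) in auto)
    then show False using D a b by blast
  qed
  moreover have "X0 \<union> X1 \<subseteq> - S" using 0 1 SU by blast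
  ultimately show ?thesis using that[of X0 X1] 0 1 by blast
qed

text \<open>In the plane the complement also contains 0, an end of the cylinder. Deleting a point
  from a connected open set of the plane leaves it connected, which is where the openness of the two
  pieces enters.\<close>

lemma cylinder_annulus_complement:
  fixes S :: "(circle \<times> real) set"
  assumes "topological_annulus S"
  obtains X1 X2 where "connected X1" "connected X2" "- S = X1 \<union> X2"
proof -
  obtain g where g: "homeomorphism UNIV (- {0}) (\<lambda>(c, t). of_real (exp t) * circle_cis c) g"
    by (rule cylinder_homeomorphism)
  define E :: "circle \<times> real \<Rightarrow> complex" where "E = (\<lambda>(c, t). of_real (exp t) * circle_cis c)"
  have hom: "homeomorphism UNIV (- {0}) E g" using g by (simp add: E_def)
  then have E: "continuous_on (- {0}) g" "\<And>p. g (E p) = p"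
      "\<And>z. z \<noteq> 0 \<Longrightarrow> E (g z) = z" "range E = - {0}"
    unfolding homeomorphism_def by (blast+)
  have "S homeomorphic (E ` S)"
    using homeomorphism_of_subsets[OF hom, of S "E ` S"] E(4) unfolding homeomorphic_def by blast
  then have "topological_annulus (E ` S)"
    using assms unfolding topological_annulus_def by (meson homeomorphic_sym homeomorphic_trans)
  then obtain X1 X2 where X: "open X1" "connected X1" "open X2" "connected X2" "- (E ` S) = X1 \<union> X2"
    by (rule plane_annulus_complement)
  have "connected (g ` (X - {0}))" if "open X" "connected X" for X
    using that by (intro connected_continuous_image continuous_on_subset[OF E(1)]
        connected_open_delete) auto
  moreover have "- S = g ` (X1 - {0}) \<union> g ` (X2 - {0})"
  proof (intro equalityI subsetI)
    fix p assume "p \<in> - S"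
    then have "E p \<in> - (E ` S)" using E(2) by (metis ComplD ComplI image_iff)
    moreover have "E p \<noteq> 0" using E(4) by blast
    ultimately have "E p \<in> (X1 - {0}) \<union> (X2 - {0})" using X(5) by blast
    then show "p \<in> g ` (X1 - {0}) \<union> g ` (X2 - {0})" using E(2)[of p] by (metis image_Un imageI)
  next
    fix p assume "p \<in> g ` (X1 - {0}) \<union> g ` (X2 - {0})"
    then obtain z where z: "p = g z" "z \<noteq> 0" "z \<in> - (E ` S)" using X(5) by auto
    then show "p \<in> - S" using E(3)[of z] by (metis ComplD ComplI imageI)
  qed
  ultimately show ?thesis using that X(1-4) by metis
qed

text \<open>Pigeonhole: two of the three points share a connected piece.\<close>

lemma not_topological_annulusI:
  fixes S :: "(circle \<times> real) set"
  assumes "a \<in> - S" "b \<in> - S" "c \<in> - S"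
    and "\<not> connected_component (- S) a b" "\<not> connected_component (- S) a c"
      "\<not> connected_component (- S) b c"
  shows "\<not> topological_annulus S"
proof
  assume "topological_annulus S"
  then obtain X1 X2 where X: "connected X1" "connected X2" "- S = X1 \<union> X2"
    by (rule cylinder_annulus_complement)
  have "connected_component (- S) x y" if "x \<in> X1 \<and> y \<in> X1 \<or> x \<in> X2 \<and> y \<in> X2" for x y
    using that
  proof
    assume "x \<in> X1 \<and> y \<in> X1"
    then show ?thesis using X unfolding connected_component_def by (intro exI[of _ X1]) auto
  next
    assume "x \<in> X2 \<and> y \<in> X2"
    then show ?thesis using X unfolding connected_component_def by (intro exI[of _ X2]) auto
  qed
  moreover have "a \<in> X1 \<or> a \<in> X2" "b \<in> X1 \<or> b \<in> X2" "c \<in> X1 \<or> c \<in> X2"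
    using assms(1-3) X(3) by auto
  ultimately show False using assms(4-6) by metis
qed

section \<open>Covering by maps close to a skew product\<close>

text \<open>A representative of least absolute value. At 1/2 its sign is an arbitrary choice, and
  continuity is claimed only within distance 1/4 of 0.\<close>

definition small_lift :: "circle \<Rightarrow> real" where
  "small_lift c = (SOME x. c = to_circle x \<and> \<bar>x\<bar> = dist c 0)"

lemma small_lift: "to_circle (small_lift c) = c" "\<bar>small_lift c\<bar> = dist c 0"
proof -
  have "\<exists>x. c = to_circle x \<and> \<bar>x\<bar> = dist c 0" by (metis to_circle_nearest)
  from someI_ex[OF this] show "to_circle (small_lift c) = c" "\<bar>small_lift c\<bar> = dist c 0"
    by (simp_all add: small_lift_def)
qed

lemma dist_small_lift:
  assumes "dist c 0 \<le> 1 / 4" "dist d 0 \<le> 1 / 4"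
  shows "dist (small_lift c) (small_lift d) = dist c d"
proof -
  have "\<bar>small_lift c - small_lift d\<bar> \<le> 1 / 2" using assms small_lift(2)[of c] small_lift(2)[of d] by linarith
  from dist_to_circle_eq[OF this] show ?thesis by (simp add: small_lift dist_real_def)
qed

lemma continuous_on_small_lift: "continuous_on (cball 0 (1 / 4)) small_lift"
  unfolding continuous_on_iff
proof (intro ballI allI impI)
  fix c :: circle and e :: real
  assume c: "c \<in> cball 0 (1 / 4)" and e: "e > 0"
  show "\<exists>d>0. \<forall>x'\<in>cball 0 (1 / 4). dist x' c < d \<longrightarrow> dist (small_lift x') (small_lift c) < e"
    using c e by (intro exI[of _ e]) (simp add: dist_commute dist_small_lift)
qed

lemma continuous_on_circle_op:
  fixes f g :: "'a :: topological_space \<Rightarrow> circle"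
  assumes "continuous_on S f" "continuous_on S g"
    and "\<And>a b c d. dist (h a b) (h c d) \<le> dist a c + dist b d"
  shows "continuous_on S (\<lambda>x. h (f x) (g x) :: circle)"
  unfolding continuous_on_def
proof
  fix a assume a: "a \<in> S"
  have "((\<lambda>x. dist (f x) (f a)) \<longlongrightarrow> 0) (at a within S)" "((\<lambda>x. dist (g x) (g a)) \<longlongrightarrow> 0) (at a within S)"
    using assms(1,2) a unfolding continuous_on_def tendsto_dist_iff[symmetric] by blast+
  from tendsto_add[OF this]
  have "((\<lambda>x. dist (f x) (f a) + dist (g x) (g a)) \<longlongrightarrow> 0) (at a within S)" by simp
  then have "((\<lambda>x. dist (h (f x) (g x)) (h (f a) (g a))) \<longlongrightarrow> 0) (at a within S)"
    by (rule tendsto_sandwich[OF _ _ tendsto_const, rotated -1])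
      (auto intro: always_eventually assms(3))
  then show "((\<lambda>x. h (f x) (g x)) \<longlongrightarrow> h (f a) (g a)) (at a within S)"
    by (simp add: tendsto_dist_iff[symmetric])
qed

lemma continuous_on_circle_diff:
  fixes f g :: "'a :: topological_space \<Rightarrow> circle"
  assumes "continuous_on S f" "continuous_on S g"
  shows "continuous_on S (\<lambda>x. f x - g x)"
  using assms by (rule continuous_on_circle_op) (rule dist_diff_le_circle)

lemma continuous_on_circle_add:
  fixes f g :: "'a :: topological_space \<Rightarrow> circle"
  assumes "continuous_on S f" "continuous_on S g"
  shows "continuous_on S (\<lambda>x. f x + g x)"
  using assms by (rule continuous_on_circle_op) (rule dist_circle_add)

lemma continuous_on_skew_map:
  assumes "continuous_on UNIV \<tau>"
  shows "continuous_on S (skew_map l \<tau>)"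
  unfolding skew_map_def split_beta
  by (intro continuous_intros continuous_on_circle_add continuous_on_compose2[OF assms]) auto

lemma dist_fst_snd_le:
  "dist (fst p) (fst q) \<le> dist p q" "\<bar>snd p - snd q\<bar> \<le> dist p (q :: 'a :: metric_space \<times> real)"
  using dist_fst_le[of p q] dist_snd_le[of p q] by (simp_all add: dist_real_def)

text \<open>In lifted coordinates, \<open>A\<^sup>-\<^sup>1 (A (y, t) + A q - F q)\<close> is a self-map of a box around \<open>(y, t)\<close>
  whose fixed points are mapped by \<open>F\<close> to \<open>A (y, t)\<close>.\<close>

lemma skew_cover:
  fixes F :: "circle \<times> real \<Rightarrow> circle \<times> real" and l t \<sigma> d m :: real and y :: circle
  defines "B \<equiv> {(c, u). dist c y \<le> \<sigma> \<and> \<bar>u - t\<bar> \<le> \<sigma>}"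
  assumes l: "0 < l" and \<tau>: "continuous_on UNIV \<tau>" and F: "continuous_on B F"
    and close: "\<And>p. p \<in> B \<Longrightarrow> dist (F p) (skew_map l \<tau> p) \<le> d"
    and d: "0 \<le> d" "d \<le> 1 / 4" "d / 2 \<le> \<sigma>"
    and m: "\<And>c. dist c y \<le> d / 2 \<Longrightarrow> \<bar>\<tau> c - \<tau> y\<bar> \<le> m" "(d + m) / l \<le> \<sigma>"
  shows "skew_map l \<tau> (y, t) \<in> F ` B"
proof -
  let ?A = "skew_map l \<tau>"
  have \<sigma>: "0 \<le> \<sigma>" using d by simp
  obtain y0 where y0: "y = to_circle y0" by (rule to_circle_nearest)
  define Q where "Q = {y0 - \<sigma>..y0 + \<sigma>} \<times> {t - \<sigma>..t + \<sigma>}"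
  define \<pi> where "\<pi> = (\<lambda>(s :: real, u :: real). (to_circle s, u))"
  define e1 where "e1 q = small_lift (fst (F (\<pi> q)) - fst (?A (\<pi> q)))" for q
  define e2 where "e2 q = snd (F (\<pi> q)) - snd (?A (\<pi> q))" for q
  \<comment> \<open>The base error is halved because the base map doubles. Evaluating
    \<open>\<tau>\<close> at the corrected point \<open>s q\<close> in \<open>\<Phi>\<close> makes
    both coordinates exact at a fixed point.\<close>
  define s where "s q = y0 - e1 q / 2" for q
  define \<Phi> where "\<Phi> q = (s q, (l * t + \<tau> y - e2 q - \<tau> (to_circle (s q))) / l)" for q
  have \<pi>B: "\<pi> q \<in> B" if "q \<in> Q" for q
  proof -
    have "\<bar>fst q - y0\<bar> \<le> \<sigma>" "\<bar>snd q - t\<bar> \<le> \<sigma>" using that by (auto simp: Q_def)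
    then show ?thesis
      using dist_to_circle_le[of "fst q" y0] by (auto simp: \<pi>_def B_def y0 split_beta dist_real_def)
  qed
  have e1: "dist (fst (F (\<pi> q)) - fst (?A (\<pi> q))) 0 \<le> d" "\<bar>e1 q\<bar> \<le> d" if "q \<in> Q" for q
    using close[OF \<pi>B[OF that]] dist_fst_snd_le(1)[of "F (\<pi> q)" "?A (\<pi> q)"]
    by (auto simp: e1_def small_lift dist_circle_diff[symmetric])
  have e2: "\<bar>e2 q\<bar> \<le> d" if "q \<in> Q" for q
    using close[OF \<pi>B[OF that]] dist_fst_snd_le(2)[of "F (\<pi> q)" "?A (\<pi> q)"] by (simp add: e2_def)
  have cont\<pi>: "continuous_on Q \<pi>"
    unfolding \<pi>_def split_beta
    by (intro continuous_intros continuous_on_compose2[OF continuous_on_to_circle[of UNIV]]) auto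
  have contF: "continuous_on Q (\<lambda>q. F (\<pi> q))" "continuous_on Q (\<lambda>q. ?A (\<pi> q))"
    by (rule continuous_on_compose2[OF F cont\<pi>] continuous_on_compose2[OF continuous_on_skew_map[OF \<tau>] cont\<pi>]; use \<pi>B in auto)+
  have "continuous_on Q e1"
    unfolding e1_def
  proof (rule continuous_on_compose2[OF continuous_on_small_lift continuous_on_circle_diff])
    show "(\<lambda>q. fst (F (\<pi> q)) - fst (?A (\<pi> q))) ` Q \<subseteq> cball 0 (1 / 4)"
      using order_trans[OF e1(1) d(2)] by (auto simp only: mem_cball dist_commute)
  qed (use contF in \<open>auto intro: continuous_intros\<close>)
  then have conts: "continuous_on Q s" unfolding s_def by (intro continuous_intros) auto
  have "continuous_on Q e2" unfolding e2_def by (intro continuous_intros contF)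
  moreover have "continuous_on Q (\<lambda>q. \<tau> (to_circle (s q)))"
    by (rule continuous_on_compose2[OF \<tau> continuous_on_compose2[OF continuous_on_to_circle[of UNIV] conts]]) auto
  ultimately have "continuous_on Q \<Phi>" unfolding \<Phi>_def using conts l by (intro continuous_intros) auto
  moreover have "\<Phi> \<in> Q \<rightarrow> Q"
  proof
    fix q assume q: "q \<in> Q"
    have s: "\<bar>s q - y0\<bar> \<le> d / 2" using e1(2)[OF q] by (simp add: s_def)
    have "dist (to_circle (s q)) y \<le> d / 2"
      using s dist_to_circle_le[of "s q" y0] by (simp add: y0 dist_real_def)
    then have "\<bar>\<tau> (to_circle (s q)) - \<tau> y\<bar> \<le> m" by (rule m)
    then have "\<bar>\<tau> y - e2 q - \<tau> (to_circle (s q))\<bar> \<le> d + m" using e2[OF q] by linarith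
    moreover have "snd (\<Phi> q) - t = (\<tau> y - e2 q - \<tau> (to_circle (s q))) / l"
      using l by (simp add: \<Phi>_def field_simps)
    ultimately have "\<bar>snd (\<Phi> q) - t\<bar> \<le> (d + m) / l"
      using l by (simp add: divide_right_mono)
    then have "\<bar>snd (\<Phi> q) - t\<bar> \<le> \<sigma>" using m(2) by linarith
    moreover have "\<bar>fst (\<Phi> q) - y0\<bar> \<le> \<sigma>" using s d by (simp add: \<Phi>_def)
    ultimately show "\<Phi> q \<in> Q" unfolding Q_def mem_Times_iff by auto
  qed
  moreover have "compact Q" "convex Q" "Q \<noteq> {}"
    using \<sigma> by (auto simp: Q_def compact_Times convex_Times)
  ultimately obtain q where q: "q \<in> Q" "\<Phi> q = q" using brouwer by metis
  then have fq: "fst q = s q" and sq: "snd q = (l * t + \<tau> y - e2 q - \<tau> (to_circle (s q))) / l"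
    by (metis \<Phi>_def fst_conv, metis \<Phi>_def snd_conv)
  have "fst (F (\<pi> q)) = fst (?A (\<pi> q)) + to_circle (e1 q)" by (simp add: e1_def small_lift)
  also have "\<dots> = to_circle (2 * s q + e1 q)"
    by (simp add: \<pi>_def skew_map_def split_beta to_circle_add fq)
  also have "2 * s q + e1 q = 2 * y0" by (simp add: s_def)
  finally have 1: "fst (F (\<pi> q)) = y + y" by (simp add: y0 to_circle_add)
  have "snd (F (\<pi> q)) = l * snd q + \<tau> (to_circle (s q)) + e2 q"
    by (simp add: e2_def \<pi>_def skew_map_def split_beta fq)
  also have "\<dots> = l * t + \<tau> y" using l by (simp add: sq)
  finally have "F (\<pi> q) = ?A (y, t)" using 1 by (simp add: prod_eq_iff skew_map_def)
  then show ?thesis using \<pi>B[OF q(1)] by (metis imageI)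
qed

section \<open>Attractors and non-wandering sets\<close>

lemma funpow_image_subset: "f ` K \<subseteq> K \<Longrightarrow> (f ^^ n) ` K \<subseteq> K"
  by (induction n) (auto simp: image_subset_iff)

lemma funpow_image_antimono:
  assumes "f ` K \<subseteq> K" "m \<le> n"
  shows "(f ^^ n) ` K \<subseteq> (f ^^ m) ` K"
proof -
  have "f ^^ n = (f ^^ m) \<circ> (f ^^ (n - m))" using assms(2) by (metis funpow_add le_add_diff_inverse)
  then show ?thesis using funpow_image_subset[OF assms(1), of "n - m"] by (auto simp: image_comp[symmetric])
qed

lemma funpow_image_supset: "W \<subseteq> f ` W \<Longrightarrow> W \<subseteq> (f ^^ n) ` W"
proof (induction n)
  case (Suc n)
  then have "f ` W \<subseteq> f ` (f ^^ n) ` W" by (intro image_mono)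
  then show ?case using Suc.prems by (simp add: image_comp)
qed simp

text \<open>Every point of \<open>W\<close> has preimages of all orders in \<open>W\<close>.\<close>

lemma subset_attractor:
  assumes "W \<subseteq> F ` W" "W \<subseteq> closure U"
  shows "W \<subseteq> attractor U F"
  using funpow_image_supset[OF assms(1)] assms(2) unfolding attractor_def
  by (meson INT_greatest image_mono order_trans)

lemma image_attractor_subset:
  assumes "F ` closure U \<subseteq> closure U"
  shows "F ` attractor U F \<subseteq> attractor U F"
proof (rule subsetI)
  fix x assume "x \<in> F ` attractor U F"
  then obtain y where y: "x = F y" "y \<in> attractor U F" by auto
  have "x \<in> (F ^^ n) ` closure U" for n
  proof -
    have "x \<in> (F ^^ Suc n) ` closure U" using y by (auto simp: attractor_def)
    then show ?thesis using funpow_image_antimono[OF assms, of n "Suc n"] by auto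
  qed
  then show "x \<in> attractor U F" by (simp add: attractor_def)
qed

text \<open>A fixed number of iterates is compared, so \<open>d\<close> may depend on
  \<open>n\<close>. Both orbits stay in \<open>K\<close>, where uniform continuity of
  \<open>A\<close> controls the accumulated error.\<close>

lemma funpow_close:
  fixes A :: "'a :: metric_space \<Rightarrow> 'a"
  assumes "compact K" "continuous_on K A" "A ` K \<subseteq> K" "e > 0"
  shows "\<exists>d>0. \<forall>F. F ` K \<subseteq> K \<longrightarrow> (\<forall>x\<in>K. dist (F x) (A x) < d) \<longrightarrow>
    (\<forall>x\<in>K. dist ((F ^^ n) x) ((A ^^ n) x) < e)"
  using assms(4)
proof (induction n arbitrary: e)
  case 0
  then show ?case by (auto intro: exI[of _ 1])
next
  case (Suc n)
  have "uniformly_continuous_on K A" using assms by (intro compact_uniformly_continuous)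
  then obtain d1 where d1: "d1 > 0"
    "\<And>x x'. x \<in> K \<Longrightarrow> x' \<in> K \<Longrightarrow> dist x' x < d1 \<Longrightarrow> dist (A x') (A x) < e / 2"
    using Suc.prems unfolding uniformly_continuous_on_def by (metis half_gt_zero)
  obtain d2 where d2: "d2 > 0" "\<And>F x. F ` K \<subseteq> K \<Longrightarrow> (\<forall>x\<in>K. dist (F x) (A x) < d2) \<Longrightarrow> x \<in> K \<Longrightarrow>
      dist ((F ^^ n) x) ((A ^^ n) x) < d1"
    using Suc.IH[OF d1(1)] by blast
  show ?case
  proof (intro exI[of _ "min d2 (e / 2)"] conjI allI impI ballI)
    show "min d2 (e / 2) > 0" using d2 Suc.prems by simp
    fix F x assume F: "F ` K \<subseteq> K" "\<forall>x\<in>K. dist (F x) (A x) < min d2 (e / 2)" and x: "x \<in> K"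
    have in_K: "(F ^^ n) x \<in> K" "(A ^^ n) x \<in> K"
      using funpow_image_subset[OF F(1)] funpow_image_subset[OF assms(3)] x by blast+
    have "dist ((F ^^ n) x) ((A ^^ n) x) < d1" using d2(2)[OF F(1) _ x] F(2) by simp
    then have "dist (A ((F ^^ n) x)) (A ((A ^^ n) x)) < e / 2" using d1(2) in_K by blast
    moreover have "dist (F ((F ^^ n) x)) (A ((F ^^ n) x)) < e / 2" using F(2) in_K by simp
    ultimately show "dist ((F ^^ Suc n) x) ((A ^^ Suc n) x) < e"
      using dist_triangle_half_r[of "A ((F ^^ n) x)"] by (simp add: dist_commute)
  qed
qed

lemma continuous_on_funpow:
  assumes "continuous_on K A" "A ` K \<subseteq> K"
  shows "continuous_on K (A ^^ n)"
proof (induction n)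
  case (Suc n)
  have "continuous_on K (A \<circ> (A ^^ n))"
    using Suc funpow_image_subset[OF assms(2)] continuous_on_subset[OF assms(1)]
    by (intro continuous_on_compose) auto
  then show ?case by simp
qed (simp add: id_def)

text \<open>The image is compact, so a point outside has positive distance from it. Absence from the
  attractor that shows at a finite time is thus an open condition.\<close>

lemma not_in_image_stable:
  fixes A :: "'a :: metric_space \<Rightarrow> 'a"
  assumes "compact K" "continuous_on K A" "A ` K \<subseteq> K" "p \<notin> (A ^^ n) ` K"
  shows "\<exists>d>0. \<forall>F. F ` K \<subseteq> K \<longrightarrow> (\<forall>x\<in>K. dist (F x) (A x) < d) \<longrightarrow> p \<notin> (F ^^ n) ` K"
proof -
  have "continuous_on K (A ^^ n)"
    by (rule continuous_on_funpow[OF assms(2,3)])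
  then have "closed ((A ^^ n) ` K)"
    using assms(1) compact_continuous_image compact_imp_closed by blast
  then obtain e where e: "e > 0" "ball p e \<inter> (A ^^ n) ` K = {}"
    using assms(4) by (metis ComplI open_Compl openE disjoint_eq_subset_Compl)
  obtain d where d: "d > 0" "\<And>F x. F ` K \<subseteq> K \<Longrightarrow> (\<forall>x\<in>K. dist (F x) (A x) < d) \<Longrightarrow> x \<in> K \<Longrightarrow>
      dist ((F ^^ n) x) ((A ^^ n) x) < e"
    using funpow_close[OF assms(1-3) e(1), of n] by blast
  show ?thesis
  proof (intro exI[of _ d] conjI allI impI notI)
    fix F assume F: "F ` K \<subseteq> K" "\<forall>x\<in>K. dist (F x) (A x) < d" "p \<in> (F ^^ n) ` K"
    then obtain x where x: "x \<in> K" "p = (F ^^ n) x" by blast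
    then have "(A ^^ n) x \<in> ball p e" using d(2)[OF F(1,2) x(1)] by simp
    then show False using e x by blast
  qed (rule d)
qed

section \<open>Iterates of skew products\<close>

lemma geometric_bound:
  fixes u :: "nat \<Rightarrow> real"
  assumes "0 \<le> l" "l < 1" "0 \<le> M" "\<And>j. j < n \<Longrightarrow> u (Suc j) \<le> l * u j + M"
  shows "u n \<le> l ^ n * u 0 + M / (1 - l)"
  using assms(4)
proof (induction n)
  case 0
  then show ?case using assms by simp
next
  case (Suc n)
  have "u (Suc n) \<le> l * u n + M" using Suc by simp
  also have "\<dots> \<le> l * (l ^ n * u 0 + M / (1 - l)) + M"
    using Suc assms(1) by (intro add_mono mult_left_mono) auto
  also have "\<dots> = l ^ Suc n * u 0 + M / (1 - l)" using assms(2) by (simp add: field_simps)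
  finally show ?case .
qed

text \<open>Iterates are affine on fibres with slope \<open>l ^ n\<close> over every base point, so
  two points of one fibre approach each other at a uniform rate.\<close>

lemma skew_map_funpow:
  "(skew_map l \<tau> ^^ n) (c, t) =
     (((\<lambda>c. c + c) ^^ n) c, l ^ n * t + snd ((skew_map l \<tau> ^^ n) (c, 0)))"
proof (induction n arbitrary: t)
  case (Suc n)
  define w where "w = snd ((skew_map l \<tau> ^^ n) (c, 0))"
  have IH: "(skew_map l \<tau> ^^ n) (c, t) = (((\<lambda>c. c + c) ^^ n) c, l ^ n * t + w)" for t
    unfolding w_def by (rule Suc.IH)
  show ?case
    by (simp only: funpow.simps o_apply IH) (simp add: skew_map_def algebra_simps)
qed simp

lemma abs_snd_skew_map_le: "\<bar>snd (skew_map l \<tau> p)\<bar> \<le> \<bar>l\<bar> * \<bar>snd p\<bar> + \<bar>\<tau> (fst p)\<bar>"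
  by (simp add: skew_map_def split_beta) (metis abs_mult abs_triangle_ineq)

lemma skew_map_funpow_bound:
  assumes "0 \<le> l" "l < 1" "\<And>c. \<bar>\<tau> c\<bar> \<le> M"
  shows "\<bar>snd ((skew_map l \<tau> ^^ n) p)\<bar> \<le> l ^ n * \<bar>snd p\<bar> + M / (1 - l)"
proof -
  have "0 \<le> M" using assms(3)[of 0] by linarith
  moreover have "\<bar>snd ((skew_map l \<tau> ^^ Suc j) p)\<bar> \<le> l * \<bar>snd ((skew_map l \<tau> ^^ j) p)\<bar> + M" for j
    using abs_snd_skew_map_le[of l \<tau> "(skew_map l \<tau> ^^ j) p"] assms(1)
      assms(3)[of "fst ((skew_map l \<tau> ^^ j) p)"] by simp
  ultimately show ?thesis
    using geometric_bound[of l M n "\<lambda>j. \<bar>snd ((skew_map l \<tau> ^^ j) p)\<bar>"] assms by simp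
qed

text \<open>Moving the lift of \<open>a\<close> by \<open>z / 2 ^ n\<close> moves its
  \<open>n\<close>-th iterate by \<open>z\<close>, and a \<open>z\<close> of absolute value at most
  1/2 reaches every target. This expansion supplies the returns in the non-wandering
  argument.\<close>

lemma circle_double_funpow_surj_ball:
  assumes "e > 0"
  shows "\<exists>n0. \<forall>n\<ge>n0. \<forall>d. \<exists>c. dist c a < e \<and> ((\<lambda>c. c + c) ^^ n) c = (d :: circle)"
proof -
  obtain n0 where n0: "(1 / 2) ^ n0 < e" using assms real_arch_pow_inv[of e "1 / 2"] by auto
  have pow: "((\<lambda>c. c + c) ^^ n) (to_circle x) = to_circle (2 ^ n * x)" for n x
    by (induction n) (simp_all add: to_circle_add algebra_simps)
  have "\<exists>c. dist c a < e \<and> ((\<lambda>c. c + c) ^^ n) c = d" if n: "n \<ge> n0" for n d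
  proof -
    obtain x where x: "a = to_circle x" by (rule to_circle_nearest)
    obtain z where z: "d - to_circle (2 ^ n * x) = to_circle z" "\<bar>z\<bar> \<le> 1 / 2"
      by (rule to_circle_nearest) auto
    show ?thesis
    proof (intro exI conjI)
      let ?c = "to_circle (x + z / 2 ^ n)"
      have "dist ?c a \<le> \<bar>z / 2 ^ n\<bar>" using dist_to_circle_le[of "x + z / 2 ^ n" x] by (simp add: x dist_real_def)
      also have "\<dots> \<le> (1 / 2) ^ n" using z(2) by (simp add: power_one_over field_simps)
      also have "\<dots> \<le> (1 / 2) ^ n0" using n by (intro power_decreasing) auto
      finally show "dist ?c a < e" using n0 by simp
      have "((\<lambda>c. c + c) ^^ n) ?c = to_circle (2 ^ n * x) + to_circle z"
        by (simp add: pow to_circle_add distrib_left)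
      then show "((\<lambda>c. c + c) ^^ n) ?c = d" using z(1) by (metis add_diff_cancel_left' diff_add_cancel add.commute)
    qed
  qed
  then show ?thesis by blast
qed

section \<open>Trapping strips and the non-wandering set\<close>

lemma closure_strip:
  "0 < T \<Longrightarrow> closure ((UNIV :: circle set) \<times> {- T<..<T :: real}) = UNIV \<times> {- T..T}"
  by (simp add: closure_Times)

lemma compact_strip: "compact ((UNIV :: circle set) \<times> {- T..T :: real})"
  by (intro compact_Times compact_UNIV_circle compact_Icc)

lemma skew_map_strip:
  assumes "0 \<le> l" "\<And>c. \<bar>\<tau> c\<bar> \<le> M" "M \<le> (1 - l) * T"
  shows "skew_map l \<tau> ` (UNIV \<times> {- T..T}) \<subseteq> UNIV \<times> {- T..T}"
proof
  fix q assume "q \<in> skew_map l \<tau> ` (UNIV \<times> {- T..T})"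
  then obtain p where p: "q = skew_map l \<tau> p" "\<bar>snd p\<bar> \<le> T" by (force simp: abs_le_iff)
  have "l * \<bar>snd p\<bar> \<le> l * T" using p assms(1) by (intro mult_left_mono)
  then have "\<bar>snd q\<bar> \<le> T"
    using abs_snd_skew_map_le[of l \<tau> p] assms(1,3) assms(2)[of "fst p"] by (simp add: p algebra_simps)
  then show "q \<in> UNIV \<times> {- T..T}" by (auto simp: mem_Times_iff)
qed

text \<open>Suppose that \<open>x\<close> is outside the image. A small neighbourhood has no return
  after more than \<open>N\<close> steps, since such orbits end in the closed image. Returns up to
  time \<open>N\<close> are excluded by separating \<open>x\<close> from its iterates, as a periodic
  point of \<open>K\<close> lies in every image.\<close>

lemma nonwandering_subset_image:
  fixes A :: "'a :: {t2_space} \<Rightarrow> 'a"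
  assumes "continuous_on UNIV A" "compact K" "A ` K \<subseteq> K" "x \<in> interior K" "x \<in> nonwandering_set A"
  shows "x \<in> (A ^^ N) ` K"
proof (rule ccontr)
  let ?Z = "(A ^^ N) ` K"
  assume x: "x \<notin> ?Z"
  have contn: "continuous_on UNIV (A ^^ n)" for n
    by (rule continuous_on_funpow[OF assms(1)]) simp
  have closed: "closed ?Z"
    using assms(2) contn by (meson compact_continuous_image compact_imp_closed continuous_on_subset subset_UNIV)
  have xK: "x \<in> K" using assms(4) interior_subset by blast
  have aperiodic: "(A ^^ n) x \<noteq> x" if "n \<ge> 1" for n
  proof
    assume per: "(A ^^ n) x = x"
    have "((A ^^ n) ^^ N) x = x" by (induction N) (simp_all add: per)
    then have "x = (A ^^ (n * N)) x" by (simp add: funpow_mult)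
    then have "x \<in> (A ^^ (n * N)) ` K" using xK by (metis imageI)
    moreover have "N \<le> n * N" using that by simp
    ultimately show False using funpow_image_antimono[OF assms(3)] x by blast
  qed
  have "\<exists>V. open V \<and> x \<in> V \<and> (A ^^ n) ` V \<inter> V = {}" if n: "n \<ge> 1" for n
  proof -
    obtain P Q where PQ: "open P" "open Q" "(A ^^ n) x \<in> P" "x \<in> Q" "P \<inter> Q = {}"
      using hausdorff[OF aperiodic[OF n]] by blast
    have "open ((A ^^ n) -` P)" using contn PQ(1) by (simp add: open_vimage)
    then show ?thesis using PQ by (intro exI[of _ "Q \<inter> (A ^^ n) -` P"]) auto
  qed
  then obtain V where V: "\<And>n. n \<ge> 1 \<Longrightarrow> open (V n)" "\<And>n. n \<ge> 1 \<Longrightarrow> x \<in> V n"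
    "\<And>n. n \<ge> 1 \<Longrightarrow> (A ^^ n) ` V n \<inter> V n = {}" by metis
  define O' where "O' = (\<Inter>n\<in>{1..N}. V n) \<inter> - ?Z \<inter> interior K"
  have "open O'" unfolding O'_def using closed V(1) by (intro open_Int open_INT) (auto simp: open_Compl)
  moreover have "x \<in> O'" using x V(2) assms(4) by (auto simp: O'_def)
  ultimately obtain n where n: "n \<ge> 1" "(A ^^ n) ` O' \<inter> O' \<noteq> {}"
    using assms(5) unfolding nonwandering_set_def by blast
  then obtain v where v: "v \<in> O'" "(A ^^ n) v \<in> O'" by blast
  show False
  proof (cases "n \<le> N")
    case True
    then have "v \<in> V n" "(A ^^ n) v \<in> V n" using v n(1) by (auto simp: O'_def)
    then show False using V(3)[OF n(1)] by blast
  next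
    case False
    have "v \<in> K" using v(1) interior_subset by (auto simp: O'_def)
    then have "(A ^^ n) v \<in> ?Z" using funpow_image_antimono[OF assms(3), of N n] False by auto
    then show False using v(2) by (auto simp: O'_def)
  qed
qed

text \<open>One inclusion comes from \<open>nonwandering_subset_image\<close>. For the other,
  \<open>x\<close> in the attractor is the \<open>m\<close>-th image of some \<open>(c, s)\<close>.
  By expansion in the base, a point near \<open>x\<close> is mapped into the fibre over
  \<open>c\<close>, and \<open>m\<close> further steps contract the fibre difference, which brings
  it back near \<open>x\<close>.\<close>

lemma nonwandering_skew_map:
  fixes \<tau> :: "circle \<Rightarrow> real"
  assumes l: "0 \<le> l" "l < 1" and \<tau>: "continuous_on UNIV \<tau>" and M: "\<And>c. \<bar>\<tau> c\<bar> \<le> M" "M < (1 - l) * T"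
  shows "nonwandering_set (skew_map l \<tau>) = attractor (UNIV \<times> {- T<..<T}) (skew_map l \<tau>)"
proof -
  let ?A = "skew_map l \<tau>"
  have "0 \<le> M" using M(1)[of 0] by linarith
  then have T: "0 < T" using M(2) l by (smt (verit) mult_nonneg_nonpos)
  have TM: "M / (1 - l) < T" using M(2) l by (simp add: field_simps)
  have lim: "(\<lambda>k. l ^ k * B) \<longlonglongrightarrow> 0" for B
    using LIMSEQ_power_zero[of l] l by (intro tendsto_mult_left_zero) auto
  have cl: "closure (UNIV \<times> {- T<..<T}) = (UNIV :: circle set) \<times> {- T..T}" by (rule closure_strip[OF T])
  show ?thesis
  proof (intro equalityI subsetI)
    fix x assume x: "x \<in> nonwandering_set ?A"
    \<comment> \<open>The given strip need not contain \<open>x\<close>. A larger invariant strip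
      has \<open>x\<close> in its interior and is absorbed by the given one after \<open>k\<close>
      steps.\<close>
    define T' where "T' = max T (\<bar>snd x\<bar> + 1)"
    have "M \<le> (1 - l) * T'"
      using M(2) l mult_left_mono[of T T' "1 - l"] unfolding T'_def by linarith
    note inv = skew_map_strip[OF l(1) M(1) this]
    have "UNIV \<times> {- T'<..<T'} \<subseteq> interior ((UNIV :: circle set) \<times> {- T'..T'})"
      by (intro interior_maximal) (auto simp: open_Times)
    moreover have "x \<in> UNIV \<times> {- T'<..<T'}"
    proof -
      have "\<bar>snd x\<bar> < T'" unfolding T'_def by linarith
      then show ?thesis by (simp add: mem_Times_iff abs_less_iff)
    qed
    ultimately have xT': "x \<in> interior (UNIV \<times> {- T'..T'})" by blast
    have "\<forall>\<^sub>F k in sequentially. l ^ k * T' < T - M / (1 - l)"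
      using lim TM by (intro order_tendstoD(2)[OF lim]) simp
    then obtain k where k: "l ^ k * T' < T - M / (1 - l)"
      by (meson eventually_happens trivial_limit_sequentially)
    have absorb: "(?A ^^ k) ` (UNIV \<times> {- T'..T'}) \<subseteq> UNIV \<times> {- T..T}"
    proof (rule image_subsetI)
      fix p :: "circle \<times> real" assume "p \<in> UNIV \<times> {- T'..T'}"
      then have "\<bar>snd p\<bar> \<le> T'" by (auto simp: mem_Times_iff)
      then have "l ^ k * \<bar>snd p\<bar> \<le> l ^ k * T'" using l by (intro mult_left_mono) auto
      then have "\<bar>snd ((?A ^^ k) p)\<bar> \<le> T"
        using skew_map_funpow_bound[where \<tau> = \<tau> and n = k and p = p, OF l M(1)] k by simp
      then show "(?A ^^ k) p \<in> UNIV \<times> {- T..T}" by (auto simp: mem_Times_iff)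
    qed
    have "x \<in> (?A ^^ n) ` (UNIV \<times> {- T..T})" for n
    proof -
      have "x \<in> (?A ^^ (n + k)) ` (UNIV \<times> {- T'..T'})"
        using continuous_on_skew_map[OF \<tau>] compact_strip inv xT' x by (rule nonwandering_subset_image)
      then show ?thesis using absorb by (auto simp: funpow_add)
    qed
    then show "x \<in> attractor (UNIV \<times> {- T<..<T}) ?A" by (simp add: attractor_def cl)
  next
    fix x assume "x \<in> attractor (UNIV \<times> {- T<..<T}) ?A"
    then have x: "x \<in> (?A ^^ n) ` (UNIV \<times> {- T..T})" for n by (simp add: attractor_def cl)
    have "\<exists>n\<ge>1. (?A ^^ n) ` V \<inter> V \<noteq> {}" if V: "open V" "x \<in> V" for V
    proof -
      obtain e where e: "e > 0" "ball x e \<subseteq> V" using V openE by blast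
      have "\<forall>\<^sub>F k in sequentially. l ^ k * (2 * T) < e"
        using e(1) by (intro order_tendstoD(2)[OF lim])
      then obtain m where m: "l ^ m * (2 * T) < e"
        by (meson eventually_happens trivial_limit_sequentially)
      obtain c s where cs: "x = (?A ^^ m) (c, s)" "s \<in> {- T..T}" using x[of m] by auto
      obtain n c' where n: "n \<ge> 1" "dist c' (fst x) < e" "((\<lambda>c. c + c) ^^ n) c' = c"
        using circle_double_funpow_surj_ball[OF e(1), of "fst x"] by (metis nat_le_linear)
      \<comment> \<open>Only the base coordinate of \<open>x\<close> is changed: \<open>v\<close> is
        close to \<open>x\<close>, and its \<open>n\<close>-th image lies over
        \<open>c\<close>.\<close>
      define v where "v = (c', snd x)"
      have "dist x v < e" using n(2) by (simp add: v_def dist_prod_def dist_commute)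
      then have vV: "v \<in> V" using e by auto
      have "x \<in> UNIV \<times> {- T..T}" using x[of 0] by simp
      then have "v \<in> UNIV \<times> {- T..T}" by (auto simp: v_def mem_Times_iff)
      then have "(?A ^^ n) v \<in> (?A ^^ n) ` (UNIV \<times> {- T..T})" by (rule imageI)
      also have "\<dots> \<subseteq> UNIV \<times> {- T..T}"
        by (rule funpow_image_subset[OF skew_map_strip[OF l(1) M(1) less_imp_le[OF M(2)]]])
      finally have "(?A ^^ n) v \<in> UNIV \<times> {- T..T}" .
      moreover have fst_v: "fst ((?A ^^ n) v) = c"
        unfolding v_def skew_map_funpow[of n l \<tau> c' "snd x"] using n(3) by (simp only: fst_conv)
      ultimately obtain s' where s': "(?A ^^ n) v = (c, s')" "s' \<in> {- T..T}"
        by (metis mem_Times_iff prod.collapse)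
      have eq: "(?A ^^ (m + n)) v = (?A ^^ m) (c, s')" by (simp add: funpow_add s')
      have "fst ((?A ^^ m) (c, s')) = fst x" "snd ((?A ^^ m) (c, s')) - snd x = l ^ m * (s' - s)"
        unfolding cs(1) skew_map_funpow[of m l \<tau> c s'] skew_map_funpow[of m l \<tau> c s]
        by (simp_all only: fst_conv snd_conv) (simp add: right_diff_distrib)
      moreover have "\<bar>l ^ m * (s' - s)\<bar> \<le> l ^ m * (2 * T)"
        unfolding abs_mult using l cs(2) s'(2) by (intro mult_mono) auto
      ultimately have "dist x ((?A ^^ (m + n)) v) < e"
        unfolding eq using m by (simp add: dist_prod_def dist_real_def abs_minus_commute)
      then have "(?A ^^ (m + n)) v \<in> V" using e by auto
      then show ?thesis using vV n(1) by (intro exI[of _ "m + n"]) auto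
    qed
    then show "x \<in> nonwandering_set ?A" by (simp add: nonwandering_set_def)
  qed
qed

section \<open>Neighbourhoods in the space of Lipschitz maps\<close>

lemma skew_map_Lip:
  assumes "L-lipschitz_on UNIV \<tau>"
  shows "restrict (skew_map l \<tau>) K \<in> Lip K"
proof -
  have "(2 + (\<bar>l\<bar> + L))-lipschitz_on K (restrict (skew_map l \<tau>) K)"
  proof (rule lipschitz_onI)
    show "0 \<le> 2 + (\<bar>l\<bar> + L)" using lipschitz_on_nonneg[OF assms] by simp
    fix p q assume pq: "p \<in> K" "q \<in> K"
    let ?A = "skew_map l \<tau>"
    have "dist (fst (?A p)) (fst (?A q)) \<le> 2 * dist p q"
      using dist_circle_add[of "fst p" "fst p" "fst q" "fst q"] dist_fst_le[of p q]
      by (simp add: skew_map_def split_beta)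
    moreover have "dist (snd (?A p)) (snd (?A q)) \<le> (\<bar>l\<bar> + L) * dist p q"
    proof -
      have "\<bar>l * snd p - l * snd q\<bar> \<le> \<bar>l\<bar> * dist p q"
        using dist_snd_le[of p q] unfolding right_diff_distrib[symmetric] abs_mult
        by (intro mult_left_mono) (auto simp: dist_real_def)
      moreover have "\<bar>\<tau> (fst p) - \<tau> (fst q)\<bar> \<le> L * dist (fst p) (fst q)"
        using lipschitz_onD[OF assms, of "fst p" "fst q"] by (simp add: dist_real_def)
      moreover have "\<dots> \<le> L * dist p q"
        using dist_fst_le[of p q] lipschitz_on_nonneg[OF assms] by (intro mult_left_mono)
      ultimately show ?thesis
        by (simp add: skew_map_def split_beta dist_real_def distrib_right)
    qed
    moreover have "dist (?A p) (?A q) \<le> dist (fst (?A p)) (fst (?A q)) + dist (snd (?A p)) (snd (?A q))"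
      unfolding dist_prod_def by (rule sqrt_sum_squares_le_sum) auto
    ultimately show "dist (restrict ?A K p) (restrict ?A K q) \<le> (2 + (\<bar>l\<bar> + L)) * dist p q"
      using pq by (simp add: distrib_right)
  qed
  then show ?thesis by (auto simp: Lip_def)
qed

lemma dist_le_dist_L:
  assumes "compact K" "F \<in> Lip K" "G \<in> Lip K" "p \<in> K"
  shows "dist (F p) (G p) \<le> dist_L K F G"
proof -
  have "dist (F p) (G p) \<le> (SUP p\<in>K. dist (F p) (G p))"
    using Lip_bdd_above[OF assms(1-3)] assms(4) by (intro cSUP_upper)
  moreover have "0 \<le> lip_const K (\<lambda>p. fst (F p) - fst (G p))" "0 \<le> lip_const K (\<lambda>p. snd (F p) - snd (G p))"
    using Lip_diff[OF assms(2,3)] lip_const_nonneg by blast+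
  ultimately show ?thesis using assms by (simp add: dist_L_def)
qed

text \<open>\<open>dist_L\<close> dominates the uniform distance, so a uniform estimate holds on a
  ball of \<open>dist_L\<close>.\<close>

lemma Lip_into_neighbourhood:
  assumes "compact (closure U)" "U \<noteq> {}" "G \<in> Lip_into U" "d > 0"
  obtains N where "openin (Lip_into_topology U) N" "G \<in> N"
    "\<And>F. F \<in> N \<Longrightarrow> F \<in> Lip_into U \<and> (\<forall>p\<in>closure U. dist (F p) (G p) < d)"
proof -
  interpret Metric_space "Lip (closure U)" "dist_L (closure U)"
    using assms by (intro Metric_space_Lip) auto
  have G: "G \<in> Lip (closure U)" using assms(3) by (simp add: Lip_into_def)
  show ?thesis
  proof (rule that[of "mball G d \<inter> Lip_into U"])
    show "openin (Lip_into_topology U) (mball G d \<inter> Lip_into U)"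
      unfolding Lip_into_topology_def by (intro openin_subtopology_Int openin_mball)
    show "G \<in> mball G d \<inter> Lip_into U" using G assms by simp
    fix F assume F: "F \<in> mball G d \<inter> Lip_into U"
    then have "F \<in> Lip (closure U)" "dist_L (closure U) F G < d"
      by (auto simp: commute)
    then show "F \<in> Lip_into U \<and> (\<forall>p\<in>closure U. dist (F p) (G p) < d)"
      using F dist_le_dist_L[OF assms(1) _ G] by force
  qed
qed

section \<open>Real-analytic approximation on the circle\<close>

text \<open>Take real parts in the Taylor series of \<open>h\<close> at a real centre; since
  \<open>y - x\<close> is real, they pass to the coefficients.\<close>

lemma entire_imp_real_analytic:
  assumes "h holomorphic_on UNIV" "\<And>x. h (of_real x) = of_real (f x)"
  shows "real_analytic f"
  unfolding real_analytic_def
proof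
  fix x :: real
  define a where "a n = Re ((deriv ^^ n) h (of_real x) / fact n)" for n
  have "(\<lambda>n. a n * (y - x) ^ n) sums f y" for y
  proof -
    have "(\<lambda>n. (deriv ^^ n) h (of_real x) / fact n * (of_real y - of_real x) ^ n) sums h (of_real y)"
      by (rule holomorphic_power_series[of h "of_real x" "dist x y + 1"])
        (use assms(1) in \<open>auto intro: holomorphic_on_subset\<close>)
    then have "(\<lambda>n. Re ((deriv ^^ n) h (of_real x) / fact n * of_real ((y - x) ^ n))) sums Re (h (of_real y))"
      by (intro sums_Re) simp
    moreover have "Re (w * of_real b) = Re w * b" for w b by simp
    ultimately show ?thesis by (simp only: a_def assms(2) Re_complex_of_real)
  qed
  then show "\<exists>r>0. \<exists>a. \<forall>y. \<bar>y - x\<bar> < r \<longrightarrow> (\<lambda>n. a n * (y - x) ^ n) sums f y"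
    by (intro exI[of _ 1] conjI exI[of _ a]) auto
qed

text \<open>On the unit circle a real polynomial is a polynomial in cosine and sine, and these
  extend to entire functions.\<close>

lemma real_polynomial_function_cis_entire:
  assumes "real_polynomial_function (g :: complex \<Rightarrow> real)"
  shows "\<exists>h. h holomorphic_on UNIV \<and> (\<forall>x. h (of_real x) = of_real (g (cis (2 * pi * x))))"
  using assms
proof induction
  case (linear f)
  interpret bounded_linear f by fact
  have f: "f (cis y) = cos y * f 1 + sin y * f \<i>" for y
  proof -
    have "cis y = cos y *\<^sub>R 1 + sin y *\<^sub>R \<i>" by (simp add: complex_eq_iff)
    then show ?thesis by (simp add: add scaleR)
  qed
  show ?case
    by (intro exI[of _ "\<lambda>z. cos (2 * of_real pi * z) * of_real (f 1) + sin (2 * of_real pi * z) * of_real (f \<i>)"]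
        conjI holomorphic_intros allI)
      (simp add: f cos_of_real[symmetric] sin_of_real[symmetric])
next
  case (const c)
  then show ?case by (intro exI[of _ "\<lambda>_. of_real c"]) auto
next
  case (add f g)
  then obtain h k where "h holomorphic_on UNIV" "\<And>x. h (of_real x) = of_real (f (cis (2 * pi * x)))"
    "k holomorphic_on UNIV" "\<And>x. k (of_real x) = of_real (g (cis (2 * pi * x)))" by blast
  then show ?case by (intro exI[of _ "\<lambda>z. h z + k z"]) (auto intro: holomorphic_intros)
next
  case (mult f g)
  then obtain h k where "h holomorphic_on UNIV" "\<And>x. h (of_real x) = of_real (f (cis (2 * pi * x)))"
    "k holomorphic_on UNIV" "\<And>x. k (of_real x) = of_real (g (cis (2 * pi * x)))" by blast
  then show ?case by (intro exI[of _ "\<lambda>z. h z * k z"]) (auto intro: holomorphic_intros)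
qed

lemma real_polynomial_function_lipschitz:
  assumes "real_polynomial_function (g :: 'a :: euclidean_space \<Rightarrow> real)" "bounded S"
  shows "\<exists>L. L-lipschitz_on S g"
proof -
  obtain R where R: "\<And>x. x \<in> S \<Longrightarrow> norm x \<le> R" using assms(2) by (auto simp: bounded_iff)
  \<comment> \<open>Boundedness is carried through the induction for the sake of products.\<close>
  have "\<exists>L B. L-lipschitz_on S g \<and> (\<forall>x\<in>S. \<bar>g x\<bar> \<le> B)"
    using assms(1)
  proof induction
    case (linear f)
    then obtain K where K: "0 \<le> K" "\<And>x. norm (f x) \<le> norm x * K"
      using bounded_linear.nonneg_bounded by blast
    have "K-lipschitz_on S f"
    proof (rule lipschitz_onI)
      fix x y
      show "dist (f x) (f y) \<le> K * dist x y"
        using K(2)[of "x - y"] linear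
        by (simp add: dist_norm bounded_linear.axioms(1) linear_diff mult.commute bounded_linear.linear)
    qed (rule K)
    moreover have "\<bar>f x\<bar> \<le> R * K" if "x \<in> S" for x
      using K(2)[of x] mult_right_mono[OF R[OF that] K(1)] by simp
    ultimately show ?case by blast
  next
    case (const c)
    have "0-lipschitz_on S (\<lambda>_. c)" by (simp add: lipschitz_on_def)
    then show ?case by blast
  next
    case (add f g)
    then obtain L1 B1 L2 B2 where *: "L1-lipschitz_on S f" "\<forall>x\<in>S. \<bar>f x\<bar> \<le> B1"
      "L2-lipschitz_on S g" "\<forall>x\<in>S. \<bar>g x\<bar> \<le> B2" by blast
    have "(L1 + L2)-lipschitz_on S (\<lambda>x. f x + g x)"
      using * by (intro lipschitz_on_sum) (auto simp: dist_real_def)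
    moreover have "\<forall>x\<in>S. \<bar>f x + g x\<bar> \<le> B1 + B2"
      using * by (auto intro: order_trans[OF abs_triangle_ineq] add_mono)
    ultimately show ?case by blast
  next
    case (mult f g)
    then obtain L1 B1 L2 B2 where *: "L1-lipschitz_on S f" "\<forall>x\<in>S. \<bar>f x\<bar> \<le> B1"
      "L2-lipschitz_on S g" "\<forall>x\<in>S. \<bar>g x\<bar> \<le> B2" by blast
    have L: "0 \<le> L1" "0 \<le> L2" using * lipschitz_on_nonneg by blast+
    have "(\<bar>B1\<bar> * L2 + \<bar>B2\<bar> * L1)-lipschitz_on S (\<lambda>x. f x * g x)"
    proof (rule lipschitz_onI)
      show "0 \<le> \<bar>B1\<bar> * L2 + \<bar>B2\<bar> * L1" using L by simp
      fix x y assume xy: "x \<in> S" "y \<in> S"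
      have d: "\<bar>f x - f y\<bar> \<le> L1 * dist x y" "\<bar>g x - g y\<bar> \<le> L2 * dist x y"
        using * xy lipschitz_onD by (fastforce simp: dist_real_def)+
      have "f x * g x - f y * g y = f x * (g x - g y) + g y * (f x - f y)" by (simp add: algebra_simps)
      then have "\<bar>f x * g x - f y * g y\<bar> \<le> \<bar>f x\<bar> * \<bar>g x - g y\<bar> + \<bar>g y\<bar> * \<bar>f x - f y\<bar>"
        by (metis abs_mult abs_triangle_ineq)
      also have "\<dots> \<le> \<bar>B1\<bar> * (L2 * dist x y) + \<bar>B2\<bar> * (L1 * dist x y)"
        using * xy d by (intro add_mono mult_mono) force+
      finally show "dist (f x * g x) (f y * g y) \<le> (\<bar>B1\<bar> * L2 + \<bar>B2\<bar> * L1) * dist x y"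
        by (simp add: dist_real_def algebra_simps)
    qed
    moreover have "\<forall>x\<in>S. \<bar>f x * g x\<bar> \<le> \<bar>B1\<bar> * \<bar>B2\<bar>"
      using * unfolding abs_mult by (intro ballI mult_mono) force+
    ultimately show ?case by blast
  qed
  then show ?thesis by blast
qed

lemma circle_cis_lipschitz: "(2 * pi)-lipschitz_on X circle_cis"
proof (rule lipschitz_onI)
  fix c d :: circle
  obtain z where z: "c - d = to_circle z" "\<bar>z\<bar> = dist (c - d) 0" "\<bar>z\<bar> \<le> 1 / 2"
    by (rule to_circle_nearest)
  obtain x where x: "d = to_circle x" by (rule to_circle_nearest)
  have "c = to_circle (x + z)" using z(1) x to_circle_add[of x z] by (metis add.commute diff_add_cancel)
  then have "circle_cis c - circle_cis d = cis (2 * pi * x) * (cis (2 * pi * z) - 1)"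
    by (simp add: x circle_cis_to_circle distrib_left cis_mult[symmetric] right_diff_distrib)
  then have "dist (circle_cis c) (circle_cis d) = norm (cis (2 * pi * z) - 1)"
    by (simp add: dist_norm norm_mult)
  also have "\<dots> = 2 * \<bar>sin (pi * z)\<bar>"
    using dist_exp_i_1[of "2 * pi * z"] by (simp add: cis_conv_exp)
  also have "\<dots> \<le> 2 * \<bar>pi * z\<bar>" using abs_sin_x_le_abs_x[of "pi * z"] by simp
  finally show "dist (circle_cis c) (circle_cis d) \<le> 2 * pi * dist c d"
    using z(2) dist_circle_diff[of c d] by (simp add: abs_mult)
qed simp

text \<open>Stone-Weierstrass on the unit circle. The Lipschitz constant is recorded because the
  skew product has to be a point of \<open>Lip\<close>.\<close>

lemma circle_real_analytic_approx:
  fixes f :: "circle \<Rightarrow> real"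
  assumes "continuous_on UNIV f" "e > 0"
  obtains \<tau> L where "circle_real_analytic \<tau>" "L-lipschitz_on UNIV \<tau>" "\<And>c. \<bar>\<tau> c - f c\<bar> < e"
proof -
  obtain h where h: "homeomorphism UNIV (sphere 0 1) circle_cis h" by (rule circle_cis_homeomorphism)
  then have hc: "continuous_on (sphere 0 1) h" "\<And>c. h (circle_cis c) = c"
    by (auto simp: homeomorphism_def)
  have "continuous_on (sphere 0 1) (\<lambda>z. f (h z))"
    by (rule continuous_on_compose2[OF assms(1) hc(1)]) auto
  then obtain g where g: "real_polynomial_function g" "\<And>z. z \<in> sphere 0 1 \<Longrightarrow> \<bar>f (h z) - g z\<bar> < e"
    by (rule Stone_Weierstrass_real_polynomial_function[OF compact_sphere _ assms(2)]) blast
  obtain k where k: "k holomorphic_on UNIV" "\<And>x. k (of_real x) = of_real (g (cis (2 * pi * x)))"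
    using real_polynomial_function_cis_entire[OF g(1)] by blast
  obtain L where L: "L-lipschitz_on (sphere 0 1) g"
    using real_polynomial_function_lipschitz[OF g(1), of "sphere 0 1"] by auto
  show ?thesis
  proof (rule that)
    show "circle_real_analytic (\<lambda>c. g (circle_cis c))"
      unfolding circle_real_analytic_def circle_cis_to_circle by (rule entire_imp_real_analytic[OF k])
    show "(L * (2 * pi))-lipschitz_on UNIV (\<lambda>c. g (circle_cis c))"
      by (rule lipschitz_on_compose2[OF circle_cis_lipschitz lipschitz_on_subset[OF L]]) auto
    show "\<bar>g (circle_cis c) - f c\<bar> < e" for c
      using g(2)[of "circle_cis c"] by (simp add: hc abs_minus_commute)
  qed
qed

section \<open>The fibre radius\<close>

text \<open>The two dips of the radius: at \<open>0\<close> of width \<open>e\<close> with slowly decaying tails, and at \<open>1 / 2\<close>.\<close>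

definition radius :: "real \<Rightarrow> real \<Rightarrow> real" where
  "radius e v = 1 - e / (2 * max e v) - max 0 (1 - (1 / 2 - v) / e) / 2"

lemma continuous_on_radius: "0 < e \<Longrightarrow> continuous_on X (radius e)"
  unfolding radius_def by (intro continuous_intros) auto

text \<open>Up to 1/4 the dip at 1/2 vanishes, and beyond 1/4 the tail of the dip at 0 is at most
  \<open>2 * e\<close>. Each dip has depth at most 1/2, so together they take away at most
  \<open>1 / 2 + 2 * e\<close>.\<close>

lemma radius_bounds:
  assumes "0 < e" "e < 1 / 4" "0 \<le> v" "v \<le> 1 / 2"
  shows "1 / 2 - 2 * e \<le> radius e v" "radius e v \<le> 1"
proof -
  have "0 \<le> e / (2 * max e v)" using assms by simp
  then show "radius e v \<le> 1" unfolding radius_def by simp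
  show "1 / 2 - 2 * e \<le> radius e v"
  proof (cases "v \<le> 1 / 4")
    case True
    have "1 \<le> (1 / 2 - v) / e" using True assms by (simp add: field_simps)
    then have "max 0 (1 - (1 / 2 - v) / e) = 0" by simp
    moreover have "e / (2 * max e v) \<le> 1 / 2" using assms by (simp add: field_simps)
    ultimately have "1 / 2 - 2 * e \<le> 1 - e / (2 * max e v) - 0 / 2" using assms(1) by argo
    then show ?thesis unfolding radius_def \<open>max 0 (1 - (1 / 2 - v) / e) = 0\<close> .
  next
    case False
    have "0 \<le> (1 / 2 - v) / e" using assms by simp
    moreover have "e / (2 * max e v) \<le> e / (2 * (1 / 4))" using False assms by (intro divide_left_mono) auto
    moreover have "max 0 (1 - (1 / 2 - v) / e) \<le> 1" using calculation(1) by simp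
    ultimately show ?thesis unfolding radius_def by argo
  qed
qed

text \<open>Here \<open>k\<close> stands for \<open>2 * l - 1\<close>. By \<open>main\<close>, the
  radius at \<open>2 * v\<close> exceeds the mean of the radii at the two preimages by at most
  \<open>e\<close>, while the factor \<open>1 + k\<close> of this mean gains at least
  \<open>k * (1 / 2 - e)\<close>. With \<open>e = k / 4\<close> the difference is the stated
  margin.\<close>

lemma radius_cover:
  assumes "0 < k" "k < 1" "0 \<le> v" "v \<le> 1 / 4"
  defines "e \<equiv> k / 4"
  shows "radius e (2 * v) + k * (1 - k) / 4 \<le> (1 + k) / 2 * (radius e v + radius e (1 / 2 - v))"
proof -
  have e: "0 < e" "e < 1 / 4" using assms by (auto simp: e_def)
  define D where "D x = e / (2 * max e x)" for x
  define P where "P = max 0 (1 - v / e) / 2"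
  have "1 \<le> (1 / 2 - v) / e" using assms(4) e by (simp add: field_simps)
  then have r1: "radius e v = 1 - D v" by (simp add: radius_def D_def)
  have r2: "radius e (1 / 2 - v) = 1 - D (1 / 2 - v) - P" by (simp add: radius_def D_def P_def)
  have r3: "radius e (2 * v) \<le> 1 - D (2 * v)" by (simp add: radius_def D_def)
  have D': "D (1 / 2 - v) \<le> 2 * e"
  proof -
    have "D (1 / 2 - v) \<le> e / (2 * (1 / 4))" unfolding D_def using assms(4) e by (intro divide_left_mono) auto
    then show ?thesis by simp
  qed
  have Dv: "D v \<le> 1 / 2" using e by (simp add: D_def field_simps)
  have P: "P \<le> 1 / 2" using e assms(3) by (simp add: P_def)
  \<comment> \<open>\<open>D\<close> is the dip at 0 and \<open>P\<close> the dip at 1/2 seen from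
    \<open>1 / 2 - v\<close>. Their average has to fit under the dip at the image; in the middle
    range this is \<open>2 - v / e \<le> e / v\<close>, the inequality of arithmetic and geometric
    means.\<close>
  have main: "(D v + P) / 2 \<le> D (2 * v)"
  proof -
    consider "2 * v \<le> e" | "e < 2 * v" "v \<le> e" | "e < v" by linarith
    then show ?thesis
    proof cases
      case 1
      then have "D (2 * v) = 1 / 2" using e by (simp add: D_def)
      then show ?thesis using Dv P by simp
    next
      case 2
      have "D v = 1 / 2" "P = (1 - v / e) / 2" "D (2 * v) = e / (4 * v)"
        using 2 e by (auto simp: D_def P_def max_def field_simps)
      moreover have "2 - v / e \<le> e / v"
      proof -
        have "2 * (v * e) \<le> v * v + e * e" using sum_squares_bound[of v e] by (simp add: power2_eq_square)
        then show ?thesis using 2 e by (simp add: field_simps)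
      qed
      ultimately show ?thesis by (simp add: field_simps)
    next
      case 3
      then have "P = 0" "D v = e / (2 * v)" "D (2 * v) = e / (4 * v)"
        using e by (auto simp: D_def P_def max_def field_simps)
      then show ?thesis by simp
    qed
  qed
  define s where "s = D v + D (1 / 2 - v) + P"
  have "s \<le> 1 + 2 * e" using Dv D' P by (simp add: s_def)
  then have "k * (1 / 2 - e) \<le> k * (1 - s / 2)" using assms(1) by (intro mult_left_mono) auto
  moreover have "radius e (2 * v) \<le> 1 - s / 2 + e" using r3 main D' unfolding s_def by argo
  moreover have "k * (1 / 2 - e) - e = k * (1 - k) / 4" by (simp add: e_def algebra_simps)
  moreover have "(1 + k) / 2 * (radius e v + radius e (1 / 2 - v)) = (1 - s / 2) + k * (1 - s / 2)"
    by (simp add: r1 r2 s_def algebra_simps add_divide_distrib)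
  ultimately show ?thesis by linarith
qed

text \<open>Both preimages of 1/2 lie at distance 1/4 from 0, where the radius is exactly twice the
  radius at 1/2. As \<open>2 * l = 1 + k > 1\<close>, a single branch covers with room.\<close>

lemma radius_crossing:
  assumes "0 < k" "k < 1"
  defines "e \<equiv> k / 4"
  shows "radius e (1 / 2) + k * (1 - k) / 8 < (1 + k) / 2 * radius e (1 / 4)"
proof -
  have "radius e (1 / 2) = 1 / 2 - e" "radius e (1 / 4) = 1 - 2 * e"
    using assms by (auto simp: radius_def e_def field_simps max_def)
  moreover have "(1 + k) / 2 * (1 - 2 * e) - (1 / 2 - e) = k * (2 - k) / 4"
    by (simp add: e_def field_simps)
  moreover have "k * (1 - k) < 2 * (k * (2 - k))"
    using assms mult_strict_left_mono[of "1 - k" "2 * (2 - k)" k] by (simp add: algebra_simps)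
  ultimately show ?thesis by simp
qed

text \<open>\<open>\<eta>\<close> is half the margin of \<open>radius_cover\<close>. The crossing
  inequality is strict at 1/4, so by continuity it extends to nearby \<open>v\<close>.\<close>

lemma radius_exists:
  fixes l :: real
  assumes "1 / 2 < l" "l < 1"
  obtains \<Lambda> :: "real \<Rightarrow> real" and \<eta> r0 where "0 < \<eta>" "\<eta> \<le> l * (1 - l)" "0 < r0" "continuous_on UNIV \<Lambda>"
    "\<And>v. 0 \<le> v \<Longrightarrow> v \<le> 1 / 2 \<Longrightarrow> 1 - l \<le> \<Lambda> v" "\<And>v. 0 \<le> v \<Longrightarrow> v \<le> 1 / 2 \<Longrightarrow> \<Lambda> v \<le> 1"
    "\<And>v. 0 \<le> v \<Longrightarrow> v \<le> 1 / 4 \<Longrightarrow> \<Lambda> (2 * v) + 2 * \<eta> \<le> l * (\<Lambda> v + \<Lambda> (1 / 2 - v))"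
    "\<And>v. \<bar>v - 1 / 4\<bar> \<le> r0 \<Longrightarrow> \<Lambda> (min (2 * v) (1 - 2 * v)) + \<eta> \<le> l * \<Lambda> v"
proof -
  define k where "k = 2 * l - 1"
  define e where "e = k / 4"
  define \<eta> where "\<eta> = k * (1 - k) / 8"
  have k: "0 < k" "k < 1" and l: "l = (1 + k) / 2" using assms by (auto simp: k_def)
  have e: "0 < e" "e < 1 / 4" using k by (auto simp: e_def)
  \<comment> \<open>The inner \<open>min\<close> is the tent map, the action of doubling on
    distances to 0.\<close>
  let ?f = "\<lambda>v. radius e (min (2 * v) (1 - 2 * v)) + \<eta> - l * radius e v"
  have "continuous_on UNIV ?f"
    by (intro continuous_intros continuous_on_compose2[OF continuous_on_radius[OF e(1)]]
        continuous_on_radius e) auto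
  then have "isCont ?f (1 / 4)" by (simp add: continuous_on_eq_continuous_at)
  moreover have "?f (1 / 4) < 0"
    using radius_crossing[OF k] by (simp add: e_def \<eta>_def l)
  ultimately have "\<forall>\<^sub>F v in at (1 / 4). ?f v < 0"
    unfolding isCont_def by (rule order_tendstoD(2))
  then have "\<forall>\<^sub>F v in nhds (1 / 4). ?f v < 0"
    using \<open>?f (1 / 4) < 0\<close> by (simp add: eventually_nhds_conv_at)
  then obtain r1 where r1: "r1 > 0" "\<And>v. dist v (1 / 4) < r1 \<Longrightarrow> ?f v < 0"
    unfolding eventually_nhds_metric by blast
  show ?thesis
  proof (rule that[where \<Lambda> = "radius e" and \<eta> = \<eta> and ?r0.0 = "r1 / 2"])
    show "0 < \<eta>" using k by (simp add: \<eta>_def)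
    have "l * (1 - l) = (1 + k) * (1 - k) / 4" by (simp add: l field_simps)
    moreover have "k * (1 - k) \<le> 2 * ((1 + k) * (1 - k))"
      using k mult_right_mono[of k "2 * (1 + k)" "1 - k"] by (simp add: mult.assoc)
    ultimately show "\<eta> \<le> l * (1 - l)" by (simp add: \<eta>_def)
    show "0 < r1 / 2" using r1 by simp
    show "continuous_on UNIV (radius e)" by (rule continuous_on_radius[OF e(1)])
    show "1 - l \<le> radius e v" "radius e v \<le> 1" if "0 \<le> v" "v \<le> 1 / 2" for v
    proof -
      have "1 - l = 1 / 2 - 2 * e" by (simp add: e_def k_def field_simps)
      then show "1 - l \<le> radius e v" "radius e v \<le> 1" using radius_bounds[OF e that] by auto
    qed
    show "radius e (2 * v) + 2 * \<eta> \<le> l * (radius e v + radius e (1 / 2 - v))"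
      if "0 \<le> v" "v \<le> 1 / 4" for v
      using radius_cover[OF k that] by (simp add: e_def \<eta>_def l)
    show "radius e (min (2 * v) (1 - 2 * v)) + \<eta> \<le> l * radius e v" if "\<bar>v - 1 / 4\<bar> \<le> r1 / 2" for v
      using r1(2)[of v] r1(1) that by (simp add: dist_real_def)
  qed
qed

section \<open>The skew product with an arch\<close>

lemma circle_double_funpow_dist:
  "dist (((\<lambda>c. c + c) ^^ i) a) (((\<lambda>c. c + c) ^^ i) b) \<le> 2 ^ i * dist a (b :: circle)"
proof (induction i)
  case (Suc i)
  let ?D = "(\<lambda>c :: circle. c + c) ^^ i"
  have "dist (?D a + ?D a) (?D b + ?D b) \<le> 2 * dist (?D a) (?D b)"
    using dist_circle_add[of "?D a" "?D a" "?D b" "?D b"] by simp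
  then show ?case using Suc by simp
qed simp

lemma dist_half_0: "dist (to_circle (1 / 2)) 0 = 1 / 2"
  using dist_to_circle_eq[of "1 / 2" 0] by (simp add: zero_circle_eq)

lemma dist_quarter_0: "dist (to_circle (1 / 4)) 0 = 1 / 4"
  using dist_to_circle_eq[of "1 / 4" 0] by (simp add: zero_circle_eq)

lemma quarter_double_funpow:
  assumes "1 \<le> i"
  shows "((\<lambda>c. c + c) ^^ i) (to_circle (1 / 4)) \<in> {0, to_circle (1 / 2)}"
  using assms
proof (induction i rule: dec_induct)
  case base
  show ?case by (simp add: to_circle_add)
next
  case (step i)
  moreover have "to_circle (1 / 2) + to_circle (1 / 2) = 0"
    using antipode_double[of 0] by simp
  ultimately show ?case by auto
qed

text \<open>The orbit of 1/4 goes to 1/2 and then stays at 0, always at distance at least 1/4 from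
  \<open>y\<close>. Since \<open>i\<close> doublings expand distances at most by
  \<open>2 ^ i\<close>, backward orbits of 1/4 and 3/4 miss a narrow bump for \<open>n\<close>
  steps.\<close>

lemma quarter_not_near_preimage:
  assumes "((\<lambda>c. c + c) ^^ i) c = y" "dist y 0 = 1 / 4" "1 \<le> i" "i \<le> n"
  shows "1 / 2 ^ (n + 2) \<le> dist c (to_circle (1 / 4))"
proof -
  let ?z = "((\<lambda>c. c + c) ^^ i) (to_circle (1 / 4))"
  have z: "dist ?z 0 = 0 \<or> dist ?z 0 = 1 / 2"
    using quarter_double_funpow[OF assms(3)] dist_half_0 by force
  have "1 / 4 \<le> dist y ?z"
    using z assms(2) dist_triangle[of y 0 ?z] dist_triangle[of ?z 0 y] by (auto simp: dist_commute)
  also have "\<dots> \<le> 2 ^ i * dist c (to_circle (1 / 4))"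
    using circle_double_funpow_dist[of i c] assms(1) by simp
  also have "\<dots> \<le> 2 ^ n * dist c (to_circle (1 / 4))"
    using assms(4) by (intro mult_right_mono power_increasing) auto
  finally show ?thesis by (simp add: field_simps)
qed

text \<open>\<open>r\<close> is the radius of the bump, \<open>H\<close> its height, and
  \<open>n\<close> the number of backward steps from 1/4 or 3/4 that miss it. The condition on
  \<open>n\<close> makes the contribution of earlier heights at most 1. The value of
  \<open>H\<close> leaves the height \<open>3 / (1 - l) + 2\<close> free between the branches
  through 3/4 and 1/4, even after \<open>tau\<close> is changed by up to 1.\<close>

locale arch_profile =
  fixes l \<eta> r H :: real and \<Lambda> :: "real \<Rightarrow> real" and n :: nat
  assumes l: "1 / 2 < l" "l < 1"
    and \<eta>: "0 < \<eta>" "\<eta> \<le> l * (1 - l)"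
    and r: "0 < r" "r \<le> 1 / 8" "r \<le> 1 / 2 ^ (n + 2)"
    and cont_\<Lambda>: "continuous_on UNIV \<Lambda>"
    and \<Lambda>_ge: "\<And>v. 0 \<le> v \<Longrightarrow> v \<le> 1 / 2 \<Longrightarrow> 1 - l \<le> \<Lambda> v"
    and \<Lambda>_le: "\<And>v. 0 \<le> v \<Longrightarrow> v \<le> 1 / 2 \<Longrightarrow> \<Lambda> v \<le> 1"
    and \<Lambda>_cover: "\<And>v. 0 \<le> v \<Longrightarrow> v \<le> 1 / 4 \<Longrightarrow> \<Lambda> (2 * v) + 2 * \<eta> \<le> l * (\<Lambda> v + \<Lambda> (1 / 2 - v))"
    and \<Lambda>_crossing: "\<And>v. \<bar>v - 1 / 4\<bar> \<le> r \<Longrightarrow> \<Lambda> (min (2 * v) (1 - 2 * v)) + \<eta> \<le> l * \<Lambda> v"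
    and H: "H = 2 * (3 / (1 - l) + 1) + 3"
    and n: "l ^ n * (1 + (H + 3) / (1 - l)) \<le> 1"
begin

text \<open>The shift by which a branch interval of radius \<open>l * \<Lambda> v\<close> comes to
  pass the end of the target interval by \<open>\<eta>\<close>; it is 0 if the unshifted interval
  already does.\<close>

definition excess :: "real \<Rightarrow> real" where
  "excess v = max 0 (\<Lambda> (min (2 * v) (1 - 2 * v)) + \<eta> - l * \<Lambda> v)"

text \<open>The clamped factor is the sign of \<open>dist y 0 - 1 / 4\<close> wherever \<open>excess\<close> does not vanish.\<close>

definition tau :: "circle \<Rightarrow> real" where
  "tau y = excess (dist y 0) * max (- 1) (min 1 ((dist y 0 - 1 / 4) / r))
     + H * max 0 (1 - dist y (to_circle (1 / 4)) / r)"

definition W :: "(circle \<times> real) set" where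
  "W = {p. \<bar>snd p\<bar> \<le> \<Lambda> (dist (fst p) 0)}"

section \<open>Size and sign of \<open>tau\<close>\<close>

lemma H_pos: "5 < H"
  using l by (simp add: H)

lemma dist_0_range: "0 \<le> dist c (0 :: circle)" "dist c (0 :: circle) \<le> 1 / 2"
  using dist_circle_le_half[of c 0] by simp_all

lemma excess_zero: "\<bar>v - 1 / 4\<bar> \<le> r \<Longrightarrow> excess v = 0"
  using \<Lambda>_crossing[of v] by (simp add: excess_def)

lemma excess_bounds:
  assumes "0 \<le> v" "v \<le> 1 / 2"
  shows "0 \<le> excess v" "excess v \<le> 2"
proof -
  have "\<Lambda> (min (2 * v) (1 - 2 * v)) \<le> 1" using assms by (intro \<Lambda>_le) (auto simp: min_def)
  moreover have "0 \<le> l * \<Lambda> v" using \<Lambda>_ge[OF assms] l by simp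
  moreover have "l * (1 - l) \<le> 1 * 1" using l by (intro mult_mono) auto
  ultimately show "excess v \<le> 2" using \<eta>(2) by (simp add: excess_def)
qed (simp add: excess_def)

lemma dist_quarter_ge: "\<bar>dist y 0 - 1 / 4\<bar> \<le> dist y (to_circle (1 / 4))"
  using dist_triangle[of y 0 "to_circle (1 / 4)"] dist_triangle[of "to_circle (1 / 4)" 0 y]
  by (simp add: dist_quarter_0 dist_commute[of "to_circle (1 / 4)" y] abs_le_iff)

lemma bump_zero: "r \<le> dist y (to_circle (1 / 4)) \<Longrightarrow> H * max 0 (1 - dist y (to_circle (1 / 4)) / r) = 0"
  using r by (simp add: field_simps max_def)

lemma tau_crossing:
  assumes "\<bar>dist y 0 - 1 / 4\<bar> \<le> r" "r \<le> dist y (to_circle (1 / 4))"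
  shows "tau y = 0"
  unfolding tau_def bump_zero[OF assms(2)] excess_zero[OF assms(1)] by simp

lemma tau_quarter: "tau (to_circle (1 / 4)) = H"
  using r by (simp add: tau_def dist_quarter_0 excess_zero)

lemma tau_lower:
  assumes "r \<le> 1 / 4 - dist y 0"
  shows "tau y = - excess (dist y 0)"
proof -
  have "r \<le> dist y (to_circle (1 / 4))" using dist_quarter_ge[of y] assms by linarith
  moreover have "(dist y 0 - 1 / 4) / r \<le> - 1" using assms r by (simp add: field_simps)
  then have "max (- 1) (min 1 ((dist y 0 - 1 / 4) / r)) = - 1" by simp
  ultimately show ?thesis by (simp add: tau_def bump_zero)
qed

lemma tau_upper:
  assumes "r \<le> dist y 0 - 1 / 4"
  shows "tau y = excess (dist y 0)"
proof -
  have "r \<le> dist y (to_circle (1 / 4))" using dist_quarter_ge[of y] assms by linarith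
  moreover have "1 \<le> (dist y 0 - 1 / 4) / r" using assms r by (simp add: field_simps)
  then have "max (- 1) (min 1 ((dist y 0 - 1 / 4) / r)) = 1" by simp
  ultimately show ?thesis by (simp add: tau_def bump_zero)
qed

lemma tau_main_part:
  fixes y :: circle
  shows "\<bar>excess (dist y 0) * max (- 1) (min 1 ((dist y 0 - 1 / 4) / r))\<bar> \<le> 2"
proof -
  have "\<bar>excess (dist y 0)\<bar> * \<bar>max (- 1) (min 1 ((dist y 0 - 1 / 4) / r))\<bar> \<le> 2 * 1"
    using excess_bounds[OF dist_0_range, of y] by (intro mult_mono) auto
  then show ?thesis by (simp add: abs_mult)
qed

lemma tau_off_bump: "r \<le> dist y (to_circle (1 / 4)) \<Longrightarrow> \<bar>tau y\<bar> \<le> 2"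
  using tau_main_part[of y] by (simp add: tau_def bump_zero)

lemma tau_bound: "\<bar>tau y\<bar> \<le> H + 2"
proof -
  have "0 \<le> H * max 0 (1 - dist y (to_circle (1 / 4)) / r)" using H_pos by simp
  moreover have "H * max 0 (1 - dist y (to_circle (1 / 4)) / r) \<le> H * 1"
    using H_pos r by (intro mult_left_mono) auto
  ultimately show ?thesis using tau_main_part[of y] unfolding tau_def by linarith
qed

lemma continuous_on_tau: "continuous_on X tau"
  unfolding tau_def excess_def using r
  by (intro continuous_intros continuous_on_compose2[OF cont_\<Lambda>]) auto

text \<open>If the preimages are near 1/4 and 3/4, one off the bump covers unshifted. Elsewhere the
  branch nearer to 0 is shifted down and the other one up; if neither covers alone, the shifted
  intervals overlap by \<open>\<Lambda>_cover\<close>.\<close>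

lemma W_covered:
  assumes "\<bar>T\<bar> \<le> \<Lambda> (dist \<theta> 0)"
  obtains y t where "y + y = \<theta>" "l * t + tau y = T" "\<bar>t\<bar> \<le> \<Lambda> (dist y 0) - \<eta> / l"
proof -
  obtain y where y: "\<theta> = y + y" "dist y 0 \<le> 1 / 4" by (rule circle_halves)
  define v where "v = dist y 0"
  define y' where "y' = y + to_circle (1 / 2)"
  have v: "0 \<le> v" "v \<le> 1 / 4" "dist y 0 = v" "dist y' 0 = 1 / 2 - v" "dist \<theta> 0 = 2 * v"
    using y dist_circle_double[of y] by (auto simp: v_def y'_def dist_circle_antipode)
  have y': "y' + y' = \<theta>" by (simp add: y'_def y antipode_double)
  define a where "a = \<Lambda> (2 * v)"
  have T: "\<bar>T\<bar> \<le> a" using assms v by (simp add: a_def)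
  have mins: "min (2 * v) (1 - 2 * v) = 2 * v" "min (2 * (1 / 2 - v)) (1 - 2 * (1 / 2 - v)) = 2 * v"
    using v by (auto simp: min_def)
  have ex: "excess v = max 0 (a + \<eta> - l * \<Lambda> v)" "excess (1 / 2 - v) = max 0 (a + \<eta> - l * \<Lambda> (1 / 2 - v))"
    unfolding excess_def a_def mins by (rule refl)+
  note goal = that
  \<comment> \<open>The height over \<open>z\<close> is forced to be \<open>(T - tau z) / l\<close>;
    the hypothesis says that \<open>T\<close> lies in the branch interval with margin
    \<open>\<eta>\<close>.\<close>
  have branch: ?thesis if z: "z + z = \<theta>" "\<bar>T - tau z\<bar> \<le> l * \<Lambda> (dist z 0) - \<eta>" for z
  proof (rule goal)
    show "z + z = \<theta>" "l * ((T - tau z) / l) + tau z = T" using z(1) l by auto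
    have "\<bar>(T - tau z) / l\<bar> \<le> (l * \<Lambda> (dist z 0) - \<eta>) / l"
      using z(2) l by (simp add: divide_right_mono)
    then show "\<bar>(T - tau z) / l\<bar> \<le> \<Lambda> (dist z 0) - \<eta> / l" using l by (simp add: diff_divide_distrib)
  qed
  have single: ?thesis if "z + z = \<theta>" "tau z = 0" "a + \<eta> \<le> l * \<Lambda> (dist z 0)" for z
    using branch[OF that(1)] that T by simp
  show ?thesis
  proof (cases "\<bar>v - 1 / 4\<bar> < r")
    case True
    have ce: "a + \<eta> \<le> l * \<Lambda> v" "a + \<eta> \<le> l * \<Lambda> (1 / 2 - v)"
      using \<Lambda>_crossing[of v] \<Lambda>_crossing[of "1 / 2 - v"] True unfolding a_def mins by auto
    \<comment> \<open>The preimages are antipodal and \<open>r\<close> is at most 1/8, so the bump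
      meets at most one of them.\<close>
    have "dist y y' = 1 / 2"
      using dist_circle_cancel_left[of y 0 "to_circle (1 / 2)"] dist_half_0
      by (simp add: y'_def dist_commute)
    then have "r \<le> dist y (to_circle (1 / 4)) \<or> r \<le> dist y' (to_circle (1 / 4))"
      using dist_triangle2[of y y' "to_circle (1 / 4)"] r by linarith
    then show ?thesis
    proof
      assume "r \<le> dist y (to_circle (1 / 4))"
      then show ?thesis using True v ce y by (intro single[of y] tau_crossing) auto
    next
      assume "r \<le> dist y' (to_circle (1 / 4))"
      then show ?thesis using True v ce y' by (intro single[of y'] tau_crossing) auto
    qed
  next
    case False
    have ty: "tau y = - excess v" "tau y' = excess (1 / 2 - v)"
      using False v tau_lower[of y] tau_upper[of y'] by auto
    consider "a + \<eta> \<le> l * \<Lambda> v" | "a + \<eta> \<le> l * \<Lambda> (1 / 2 - v)"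
      | "l * \<Lambda> v < a + \<eta>" "l * \<Lambda> (1 / 2 - v) < a + \<eta>" by linarith
    then show ?thesis
    proof cases
      case 1
      then show ?thesis using y v ty ex by (intro single[of y]) auto
    next
      case 2
      then show ?thesis using y' v ty ex by (intro single[of y']) auto
    next
      case 3
      have t: "tau y = - (a + \<eta> - l * \<Lambda> v)" "tau y' = a + \<eta> - l * \<Lambda> (1 / 2 - v)"
        using 3 ty ex by auto
      have c: "a + 2 * \<eta> \<le> l * \<Lambda> v + l * \<Lambda> (1 / 2 - v)"
        using \<Lambda>_cover[OF v(1,2)] by (simp add: a_def distrib_left)
      show ?thesis
      \<comment> \<open>The threshold is the upper end of the interval reached through
        \<open>y\<close> with margin \<open>\<eta>\<close>, whose lower end is \<open>- a\<close>.
        By \<open>c\<close>, the interval reached through \<open>y'\<close> begins no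
        higher.\<close>
      proof (cases "T \<le> 2 * (l * \<Lambda> v) - a - 2 * \<eta>")
        case True
        then show ?thesis using y v t T by (intro branch[of y]) (auto simp: abs_le_iff)
      next
        case False
        then show ?thesis using y' v t T c by (intro branch[of y']) (auto simp: abs_le_iff)
      qed
    qed
  qed
qed

text \<open>The slack \<open>\<eta> / l\<close> leaves room in \<open>W\<close> for a box around
  \<open>(y, t)\<close>, to which \<open>skew_cover\<close> applies. Compactness of the circle makes
  its size, and hence \<open>d\<close>, independent of the point.\<close>

lemma robust_cover:
  obtains d where "d > 0"
    "\<And>F y t. continuous_on W F \<Longrightarrow> (\<And>p. p \<in> W \<Longrightarrow> dist (F p) (skew_map l tau p) \<le> d) \<Longrightarrow>
      \<bar>t\<bar> \<le> \<Lambda> (dist y 0) - \<eta> / l \<Longrightarrow> skew_map l tau (y, t) \<in> F ` W"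
proof -
  have "continuous_on UNIV (\<lambda>c :: circle. \<Lambda> (dist c 0))"
    by (intro continuous_on_compose2[OF cont_\<Lambda>] continuous_intros) auto
  then have "uniformly_continuous_on UNIV (\<lambda>c :: circle. \<Lambda> (dist c 0))"
    by (intro compact_uniformly_continuous compact_UNIV_circle)
  moreover have pos: "0 < \<eta> / (2 * l)" using \<eta> l by simp
  ultimately obtain s where s: "s > 0"
    "\<And>c y :: circle. dist c y < s \<Longrightarrow> \<bar>\<Lambda> (dist c 0) - \<Lambda> (dist y 0)\<bar> < \<eta> / (2 * l)"
    unfolding uniformly_continuous_on_def dist_real_def by (metis UNIV_I)
  \<comment> \<open>Half of the slack pays for the variation of \<open>\<Lambda>\<close> over the
    box, the other half for the height of the box.\<close>
  define \<sigma> where "\<sigma> = min (s / 2) (\<eta> / (2 * l))"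
  have \<sigma>: "0 < \<sigma>" "\<sigma> < s" "\<sigma> \<le> \<eta> / (2 * l)" using s pos by (auto simp: \<sigma>_def)
  have "uniformly_continuous_on UNIV tau"
    by (intro compact_uniformly_continuous compact_UNIV_circle continuous_on_tau)
  moreover have "0 < l * \<sigma> / 2" using \<sigma> l by simp
  ultimately obtain \<rho> where \<rho>: "\<rho> > 0"
    "\<And>c y :: circle. dist c y < \<rho> \<Longrightarrow> \<bar>tau c - tau y\<bar> < l * \<sigma> / 2"
    unfolding uniformly_continuous_on_def dist_real_def by (metis UNIV_I)
  \<comment> \<open>The four bounds permit lifting the base error, control \<open>tau\<close> under
    a base correction of \<open>d / 2\<close>, keep this correction inside the box, and leave half
    of \<open>l * \<sigma>\<close> for the variation of \<open>tau\<close>.\<close>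
  define d where "d = min (min (1 / 4) \<rho>) (min (2 * \<sigma>) (l * \<sigma> / 2))"
  have d: "0 < d" "d \<le> 1 / 4" "d \<le> \<rho>" "d \<le> 2 * \<sigma>" "d \<le> l * \<sigma> / 2"
    unfolding d_def using \<rho>(1) \<sigma>(1) \<open>0 < l * \<sigma> / 2\<close> by linarith+
  show ?thesis
  proof (rule that[OF d(1)])
    fix F and y :: circle and t
    assume F: "continuous_on W F" "\<And>p. p \<in> W \<Longrightarrow> dist (F p) (skew_map l tau p) \<le> d"
      and t: "\<bar>t\<bar> \<le> \<Lambda> (dist y 0) - \<eta> / l"
    let ?B = "{(c, u). dist c y \<le> \<sigma> \<and> \<bar>u - t\<bar> \<le> \<sigma>}"
    have BW: "?B \<subseteq> W"
    proof clarify
      fix c u assume cu: "dist c y \<le> \<sigma>" "\<bar>u - t\<bar> \<le> \<sigma>"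
      have "\<bar>\<Lambda> (dist c 0) - \<Lambda> (dist y 0)\<bar> < \<eta> / (2 * l)" using s(2) cu(1) \<sigma>(2) by simp
      moreover have "\<eta> / (2 * l) + \<eta> / (2 * l) = \<eta> / l" by simp
      ultimately have "\<bar>u\<bar> \<le> \<Lambda> (dist c 0)" using cu(2) t \<sigma>(3) by linarith
      then show "(c, u) \<in> W" by (simp add: W_def)
    qed
    have "skew_map l tau (y, t) \<in> F ` ?B"
    proof (rule skew_cover)
      show "(d + l * \<sigma> / 2) / l \<le> \<sigma>" using d(5) l by (simp add: field_simps)
      show "\<bar>tau c - tau y\<bar> \<le> l * \<sigma> / 2" if "dist c y \<le> d / 2" for c
        using \<rho>(2)[of c y] that d(1,3) by simp
      show "dist (F p) (skew_map l tau p) \<le> d" if "p \<in> ?B" for p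
        using F(2) that BW by blast
    qed (use l d continuous_on_tau continuous_on_subset[OF F(1) BW] in auto)
    then show "skew_map l tau (y, t) \<in> F ` W" using BW by blast
  qed
qed

section \<open>Interior points and components of the complement\<close>

lemma strip_subset_W: "UNIV \<times> {- (1 - l)..1 - l} \<subseteq> W"
proof clarify
  fix c :: circle and t assume "t \<in> {- (1 - l)..1 - l}"
  then have "\<bar>t\<bar> \<le> 1 - l" by auto
  then show "(c, t) \<in> W" using \<Lambda>_ge[OF dist_0_range, of c] by (simp add: W_def)
qed

lemma W_subset_strip: "W \<subseteq> UNIV \<times> {- 1..1}"
proof
  fix p assume "p \<in> W"
  then have "\<bar>snd p\<bar> \<le> 1" using \<Lambda>_le[OF dist_0_range, of "fst p"] by (simp add: W_def)
  then show "p \<in> UNIV \<times> {- 1..1}" by (auto simp: mem_Times_iff)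
qed

text \<open>The region \<open>V\<close> between the zero section and the arch has its boundary in
  \<open>S\<close>, so a connected subset of the complement that meets \<open>V\<close> cannot leave
  it. But \<open>V\<close> lies over a short arc around 1/2.\<close>

lemma arch_separates:
  assumes zero: "\<And>c. (c, 0) \<in> S" and graph: "\<And>y. (y + y, tau y) \<in> S"
    and h: "0 < h" "h < H" and D: "connected D" "D \<subseteq> - S" "(to_circle (1 / 2), h) \<in> D"
  shows "(0, T) \<notin> D"
proof -
  let ?h = "to_circle (1 / 2)"
  \<comment> \<open>The inverse branch of doubling near 1/2 that takes 1/2 to 1/4.\<close>
  define \<kappa> where "\<kappa> c = to_circle (1 / 4) + to_circle (small_lift (c - ?h) / 2)" for c
  define f where "f c = tau (\<kappa> c)" for c
  have double: "\<kappa> c + \<kappa> c = c" for c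
  proof -
    let ?s = "small_lift (c - ?h)"
    have "\<kappa> c + \<kappa> c = to_circle (1 / 2 + ?s)" by (simp add: \<kappa>_def to_circle_add)
    also have "\<dots> = ?h + (c - ?h)" by (simp add: to_circle_add[symmetric] small_lift)
    finally show ?thesis by simp
  qed
  have \<kappa>h: "\<kappa> ?h = to_circle (1 / 4)"
    using small_lift(2)[of 0] by (simp add: \<kappa>_def to_circle_add)
  have "continuous_on (cball ?h (1 / 4)) (\<lambda>c. small_lift (c - ?h))"
  proof (rule continuous_on_compose2[OF continuous_on_small_lift continuous_on_circle_diff])
    have "dist 0 (c - ?h) = dist ?h c" for c by (metis dist_circle_diff dist_commute)
    then show "(\<lambda>c. c - ?h) ` cball ?h (1 / 4) \<subseteq> cball 0 (1 / 4)" by auto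
  qed (auto intro: continuous_intros)
  then have "continuous_on (cball ?h (1 / 4)) \<kappa>"
    unfolding \<kappa>_def
    by (intro continuous_on_circle_add continuous_on_compose2[OF continuous_on_to_circle[of UNIV]]
        continuous_intros) auto
  then have f: "continuous_on (cball ?h (1 / 4)) f"
    unfolding f_def by (rule continuous_on_compose2[OF continuous_on_tau[of UNIV]]) auto
  \<comment> \<open>The radius is \<open>2 * r\<close> because the inverse branch halves distances.
    At the ends of the arc the bump has died out and \<open>f\<close> is 0, so the arch closes up
    with the zero section.\<close>
  define V where "V = {p. dist ?h (fst p) < 2 * r \<and> 0 < snd p \<and> snd p < f (fst p)}"
  define V' where "V' = {p. dist ?h (fst p) \<le> 2 * r \<and> 0 \<le> snd p \<and> snd p \<le> f (fst p)}"
  have fs: "continuous_on (cball ?h (2 * r) \<times> UNIV) (\<lambda>p. f (fst p) - snd p)"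
    using r by (intro continuous_intros continuous_on_compose2[OF f]) auto
  have "open V"
  proof -
    have "open ((ball ?h (2 * r) \<times> {0<..}) \<inter> (\<lambda>p. f (fst p) - snd p) -` {0<..})"
      by (intro continuous_open_preimage continuous_on_subset[OF fs] open_Times) auto
    also have "\<dots> = V" by (auto simp: V_def mem_Times_iff)
    finally show ?thesis .
  qed
  have "closed V'"
  proof -
    have "closed ((cball ?h (2 * r) \<times> {0..}) \<inter> (\<lambda>p. f (fst p) - snd p) -` {0..})"
      by (intro continuous_closed_preimage continuous_on_subset[OF fs] closed_Times) auto
    also have "\<dots> = V'" by (auto simp: V'_def mem_Times_iff)
    finally show ?thesis .
  qed
  have "p \<in> S" if p: "p \<in> V'" "p \<notin> V" for p
  proof -
    have "snd p = 0 \<or> snd p = f (fst p) \<or> dist ?h (fst p) = 2 * r"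
      using p by (auto simp: V_def V'_def)
    moreover have "f (fst p) = 0" if e: "dist ?h (fst p) = 2 * r"
    proof -
      define z where "z = small_lift (fst p - ?h) / 2"
      have "\<bar>small_lift (fst p - ?h)\<bar> = 2 * r"
        using e dist_circle_diff[of "fst p" ?h] by (simp add: small_lift(2) dist_commute)
      then have z: "\<bar>z\<bar> = r" by (simp add: z_def)
      then have "dist (\<kappa> (fst p)) (to_circle (1 / 4)) = r"
        using dist_to_circle_eq[of "1 / 4 + z" "1 / 4"] r by (simp add: \<kappa>_def to_circle_add z_def)
      then show ?thesis
        using dist_quarter_ge[of "\<kappa> (fst p)"] unfolding f_def by (intro tau_crossing) auto
    qed
    ultimately have "snd p = 0 \<or> snd p = f (fst p)" using p(1) by (auto simp: V'_def)
    then show ?thesis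
      using zero[of "fst p"] graph[of "\<kappa> (fst p)"] double[of "fst p"]
      by (metis f_def prod.collapse)
  qed
  then have "D \<subseteq> V \<union> - V'" using D(2) by blast
  moreover have "V \<subseteq> V'" by (auto simp: V_def V'_def)
  ultimately have "V \<inter> D = {} \<or> - V' \<inter> D = {}"
    using \<open>open V\<close> \<open>closed V'\<close> by (intro connectedD[OF D(1)]) (auto simp: open_Compl)
  moreover have "(?h, h) \<in> V" using h r by (simp add: V_def f_def \<kappa>h tau_quarter)
  ultimately have "D \<subseteq> V'" using D(3) by blast
  moreover have "(0, T) \<notin> V'" using r by (simp add: V'_def dist_half_0)
  ultimately show ?thesis by blast
qed

text \<open>The arch separates the point under it from the one above, and the zero section separates
  both from the point below.\<close>

lemma not_annulus:
  assumes zero: "\<And>c. (c, 0) \<in> S" and graph: "\<And>y. (y + y, tau y) \<in> S"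
    and h: "0 < h" "h < H" and T: "0 < T"
    and out: "(to_circle (1 / 2), h) \<notin> S" "(0, T) \<notin> S" "(0, - T) \<notin> S"
  shows "\<not> topological_annulus S"
proof -
  have sep: "\<not> connected_component (- S) a b" if "0 < snd a" "snd b < 0" for a b
  proof
    assume "connected_component (- S) a b"
    then obtain D where D: "connected D" "D \<subseteq> - S" "a \<in> D" "b \<in> D"
      by (auto simp: connected_component_def)
    have "connected (snd ` D)" by (intro connected_continuous_image D continuous_intros)
    then have "0 \<in> snd ` D"
      using connected_contains_Icc[of "snd ` D" "snd b" "snd a"] D(3,4) that by auto
    then obtain c where "(c, 0) \<in> D" by auto
    then show False using zero D(2) by blast
  qed
  show ?thesis
  proof (rule not_topological_annulusI)
    show "(to_circle (1 / 2), h) \<in> - S" "(0, T) \<in> - S" "(0, - T) \<in> - S" using out by auto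
    show "\<not> connected_component (- S) (to_circle (1 / 2), h) (0, T)"
      using arch_separates[OF zero graph h] unfolding connected_component_def by blast
    show "\<not> connected_component (- S) (to_circle (1 / 2), h) (0, - T)"
      "\<not> connected_component (- S) (0, T) (0, - T)"
      using sep h T by auto
  qed
qed

text \<open>The first \<open>k\<close> steps forget the strip; the next \<open>n\<close> miss the
  bump and leave a height of at most \<open>3 / (1 - l) + 1\<close>. The last step then ends
  strictly below the given point if made through 3/4, and strictly above it if made through
  1/4.\<close>

lemma hole_outside:
  assumes close: "\<And>c. \<bar>\<tau> c - tau c\<bar> \<le> 1"
  shows "\<exists>N. (to_circle (1 / 2), 3 / (1 - l) + 2) \<notin> (skew_map l \<tau> ^^ N) ` (UNIV \<times> {- T..T})"
proof -
  let ?A = "skew_map l \<tau>" and ?q = "to_circle (1 / 4)"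
  have \<tau>_le: "\<bar>\<tau> c\<bar> \<le> H + 3" for c using close[of c] tau_bound[of c] by linarith
  have l01: "0 \<le> l" "l < 1" using l by auto
  have "(\<lambda>k. l ^ k * T) \<longlonglongrightarrow> 0"
    using LIMSEQ_power_zero[of l] l by (intro tendsto_mult_left_zero) auto
  then have "\<forall>\<^sub>F k in sequentially. l ^ k * T < 1" by (rule order_tendstoD) simp
  then obtain k where k: "l ^ k * T < 1"
    by (meson eventually_happens trivial_limit_sequentially)
  have "(to_circle (1 / 2), 3 / (1 - l) + 2) \<notin> (?A ^^ Suc (n + k)) ` (UNIV \<times> {- T..T})"
  proof
    assume "(to_circle (1 / 2), 3 / (1 - l) + 2) \<in> (?A ^^ Suc (n + k)) ` (UNIV \<times> {- T..T})"
    then obtain x where x: "x \<in> UNIV \<times> {- T..T}"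
      "?A ((?A ^^ (n + k)) x) = (to_circle (1 / 2), 3 / (1 - l) + 2)" by auto
    define w where "w j = (?A ^^ (j + k)) x" for j
    define y where "y = fst (w n)"
    have wS: "w (Suc j) = ?A (w j)" for j by (simp add: w_def)
    have yy: "y + y = to_circle (1 / 2)" and hy: "l * snd (w n) + \<tau> y = 3 / (1 - l) + 2"
      using x(2) by (simp_all add: w_def y_def skew_map_def split_beta)
    have y4: "dist y 0 = 1 / 4"
      using dist_circle_double[of y] yy dist_half_0 by (auto split: if_splits)
    have orbit: "((\<lambda>c. c + c) ^^ i) (fst (w j)) = fst (w (i + j))" for i j
      by (induction i) (simp_all add: wS, simp add: skew_map_def split_beta)
    have "\<bar>snd (w (Suc j))\<bar> \<le> l * \<bar>snd (w j)\<bar> + 3" if j: "j < n" for j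
    proof -
      have "((\<lambda>c. c + c) ^^ (n - j)) (fst (w j)) = y" using j by (simp add: orbit y_def)
      then have "r \<le> dist (fst (w j)) ?q"
        using quarter_not_near_preimage[OF _ y4, where i = "n - j" and n = n] j r(3) by force
      then have "\<bar>\<tau> (fst (w j))\<bar> \<le> 3" using tau_off_bump close[of "fst (w j)"] by force
      then show ?thesis using abs_snd_skew_map_le[of l \<tau> "w j"] l by (simp add: wS)
    qed
    then have "\<bar>snd (w n)\<bar> \<le> l ^ n * \<bar>snd (w 0)\<bar> + 3 / (1 - l)"
      using geometric_bound[OF l01, of 3 n "\<lambda>j. \<bar>snd (w j)\<bar>"] by simp
    moreover have "\<bar>snd (w 0)\<bar> \<le> 1 + (H + 3) / (1 - l)"
    proof -
      have "\<bar>snd x\<bar> \<le> T" using x(1) by (auto simp: mem_Times_iff)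
      then have "l ^ k * \<bar>snd x\<bar> \<le> l ^ k * T" using l by (intro mult_left_mono) auto
      then show ?thesis
        using skew_map_funpow_bound[where \<tau> = \<tau> and n = k and p = x, OF l01 \<tau>_le] k by (simp add: w_def)
    qed
    then have "l ^ n * \<bar>snd (w 0)\<bar> \<le> l ^ n * (1 + (H + 3) / (1 - l))"
      using l by (intro mult_left_mono) auto
    then have "l ^ n * \<bar>snd (w 0)\<bar> \<le> 1" using n by linarith
    ultimately have wn: "\<bar>snd (w n)\<bar> \<le> 3 / (1 - l) + 1" by linarith
    have strict: "\<bar>l * snd (w n)\<bar> < 3 / (1 - l) + 1"
    proof (cases "snd (w n) = 0")
      case True
      have "0 < 3 / (1 - l)" using l by simp
      then show ?thesis unfolding True by linarith
    next
      case False
      then have "l * \<bar>snd (w n)\<bar> < 1 * \<bar>snd (w n)\<bar>" using l by (intro mult_strict_right_mono) auto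
      then show ?thesis using wn l by (simp add: abs_mult)
    qed
    show False
    proof (cases "r \<le> dist y ?q")
      case True
      then have "tau y = 0" using y4 r by (intro tau_crossing) auto
      then have "\<tau> y \<le> 1" using close[of y] by simp
      then show False using hy strict by linarith
    next
      case False
      \<comment> \<open>Doubling kills \<open>y - ?q\<close>, which is therefore 0 or 1/2, and 1/2
        is too far away from the bump.\<close>
      have "y = ?q"
      proof (rule ccontr)
        assume ne: "y \<noteq> ?q"
        have "dist ((y - ?q) + (y - ?q)) 0 = 0"
        proof -
          have "(y - ?q) + (y - ?q) = (y + y) - (?q + ?q)" by (simp add: algebra_simps)
          then show ?thesis using yy by (simp add: to_circle_add)
        qed
        then have "dist (y - ?q) 0 = 0 \<or> dist (y - ?q) 0 = 1 / 2"
          using dist_circle_double[of "y - ?q"] by (auto split: if_splits)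
        then show False using ne False r by (auto simp: dist_circle_diff[of y ?q])
      qed
      then have "H - 1 \<le> \<tau> y" using close[of y] tau_quarter by simp
      then show False using hy strict H by simp
    qed
  qed
  then show ?thesis by blast
qed

text \<open>The arch lies in the attractor of \<open>F\<close> itself: the zero section keeps
  distance \<open>\<eta> / l\<close> from the top and bottom of \<open>W\<close> in each fibre, so
  its image under the skew product with \<open>tau\<close> is covered by \<open>F\<close> on
  \<open>W\<close>, and the attractor is forward invariant.\<close>

lemma attractor_properties:
  assumes robust: "\<And>y t. \<bar>t\<bar> \<le> \<Lambda> (dist y 0) - \<eta> / l \<Longrightarrow> skew_map l tau (y, t) \<in> F ` W"
    and U: "U = UNIV \<times> {- T<..<T}" "1 \<le> T" and FU: "F ` closure U \<subseteq> U"
    and hole: "(to_circle (1 / 2), 3 / (1 - l) + 2) \<notin> attractor U F"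
  shows "interior (attractor U F) \<noteq> {}" "\<not> topological_annulus (attractor U F)"
proof -
  have cl: "closure U = UNIV \<times> {- T..T}" using U closure_strip[of T] by simp
  have FU': "F ` closure U \<subseteq> closure U" using FU closure_subset by blast
  have "W \<subseteq> closure U" using W_subset_strip U(2) by (fastforce simp: cl)
  moreover have "W \<subseteq> F ` W"
  proof
    fix p assume "p \<in> W"
    then have "\<bar>snd p\<bar> \<le> \<Lambda> (dist (fst p) 0)" by (simp add: W_def)
    then obtain y t where "y + y = fst p" "l * t + tau y = snd p" "\<bar>t\<bar> \<le> \<Lambda> (dist y 0) - \<eta> / l"
      by (rule W_covered)
    then show "p \<in> F ` W" using robust[of t y] by (simp add: skew_map_def)
  qed
  ultimately have W: "W \<subseteq> attractor U F" by (intro subset_attractor)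
  have l1: "0 < 1 - l" using l by simp
  have "UNIV \<times> {- (1 - l)<..<1 - l} \<subseteq> UNIV \<times> {- (1 - l)..1 - l}" by auto
  then have "UNIV \<times> {- (1 - l)<..<1 - l} \<subseteq> interior (attractor U F)"
    using strip_subset_W W by (intro interior_maximal) (blast, simp add: open_Times)
  then show "interior (attractor U F) \<noteq> {}" using l1 by fastforce
  show "\<not> topological_annulus (attractor U F)"
  proof (rule not_annulus)
    show "(c, 0) \<in> attractor U F" for c
    proof -
      have "(c, 0) \<in> UNIV \<times> {- (1 - l)..1 - l}" using l1 by simp
      then show ?thesis using W strip_subset_W by blast
    qed
    show "(y + y, tau y) \<in> attractor U F" for y
    proof -
      have "\<eta> / l \<le> 1 - l" using \<eta>(2) l by (simp add: field_simps)
      then have "\<bar>0\<bar> \<le> \<Lambda> (dist y 0) - \<eta> / l" using \<Lambda>_ge[OF dist_0_range, of y] by simp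
      from robust[OF this] have "(y + y, tau y) \<in> F ` W" by (simp add: skew_map_def)
      then show ?thesis using W image_attractor_subset[OF FU'] by blast
    qed
    have "0 < 3 / (1 - l)" using l1 by simp
    then show "0 < 3 / (1 - l) + 2" "3 / (1 - l) + 2 < H" unfolding H by argo+
    show "0 < T" using U by simp
    \<comment> \<open>One application of \<open>F\<close> leaves the boundary of the strip, so the
      points at heights \<open>T\<close> and \<open>- T\<close> belong to the complement.\<close>
    have "attractor U F \<subseteq> (F ^^ 1) ` closure U" unfolding attractor_def by blast
    then have "attractor U F \<subseteq> U" using FU by simp
    then show "(0, T) \<notin> attractor U F" "(0, - T) \<notin> attractor U F" using U by auto
  qed (rule hole)
qed

end

section \<open>Choice of constants, analytic approximation and robustness\<close>

theorem proposition7p4: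
  fixes l :: real
  assumes "1 / 2 < l" and "l < 1"
  shows "\<exists>\<tau> :: circle \<Rightarrow> real.
    circle_real_analytic \<tau> \<and>
    interior (nonwandering_set (skew_map l \<tau>)) \<noteq> {} \<and>
    \<not> topological_annulus (nonwandering_set (skew_map l \<tau>)) \<and>
    (\<forall>T0>0. \<forall>U. U = UNIV \<times> {-T0<..<T0} \<and> skew_map l \<tau> ` closure U \<subseteq> U \<longrightarrow>
      (\<exists>N. openin (Lip_into_topology U) N \<and>
           restrict (skew_map l \<tau>) (closure U) \<in> N \<and>
           (\<forall>F\<in>N. interior (attractor U F) \<noteq> {} \<and> \<not> topological_annulus (attractor U F))))"
proof -
  obtain \<Lambda> :: "real \<Rightarrow> real" and \<eta> r0 where \<Lambda>: "0 < \<eta>" "\<eta> \<le> l * (1 - l)" "0 < r0" "continuous_on UNIV \<Lambda>"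
    "\<And>v. 0 \<le> v \<Longrightarrow> v \<le> 1 / 2 \<Longrightarrow> 1 - l \<le> \<Lambda> v" "\<And>v. 0 \<le> v \<Longrightarrow> v \<le> 1 / 2 \<Longrightarrow> \<Lambda> v \<le> 1"
    "\<And>v. 0 \<le> v \<Longrightarrow> v \<le> 1 / 4 \<Longrightarrow> \<Lambda> (2 * v) + 2 * \<eta> \<le> l * (\<Lambda> v + \<Lambda> (1 / 2 - v))"
    "\<And>v. \<bar>v - 1 / 4\<bar> \<le> r0 \<Longrightarrow> \<Lambda> (min (2 * v) (1 - 2 * v)) + \<eta> \<le> l * \<Lambda> v"
    by (rule radius_exists[OF assms]) (rule that; assumption)
  define H where "H = 2 * (3 / (1 - l) + 1) + 3"
  have "(\<lambda>n. l ^ n * (1 + (H + 3) / (1 - l))) \<longlonglongrightarrow> 0"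
    using LIMSEQ_power_zero[of l] assms by (intro tendsto_mult_left_zero) auto
  then have "\<forall>\<^sub>F n in sequentially. l ^ n * (1 + (H + 3) / (1 - l)) < 1" by (rule order_tendstoD) simp
  then obtain n where n: "l ^ n * (1 + (H + 3) / (1 - l)) < 1"
    by (meson eventually_happens trivial_limit_sequentially)
  \<comment> \<open>\<open>n\<close> is fixed first, because the bump radius must not exceed
    \<open>1 / 2 ^ (n + 2)\<close>.\<close>
  define r where "r = Min {r0, 1 / 8, 1 / 2 ^ (n + 2)}"
  have r: "0 < r" "r \<le> 1 / 8" "r \<le> 1 / 2 ^ (n + 2)" "r \<le> r0" using \<Lambda>(3) by (auto simp: r_def)
  interpret arch_profile l \<eta> r H \<Lambda> n
    by unfold_locales (use assms \<Lambda> r n in \<open>auto simp: H_def\<close>)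
  obtain d0 where d0: "d0 > 0"
    "\<And>F y t. continuous_on W F \<Longrightarrow> (\<And>p. p \<in> W \<Longrightarrow> dist (F p) (skew_map l tau p) \<le> d0) \<Longrightarrow>
      \<bar>t\<bar> \<le> \<Lambda> (dist y 0) - \<eta> / l \<Longrightarrow> skew_map l tau (y, t) \<in> F ` W"
    using robust_cover by metis
  \<comment> \<open>Half of the tolerance goes into replacing \<open>tau\<close> by
    \<open>\<tau>\<close>, the other half into replacing the skew product by
    \<open>F\<close>.\<close>
  define d where "d = min d0 1 / 2"
  have d: "0 < d" "2 * d \<le> d0" "d < 1" using d0 by (auto simp: d_def)
  obtain \<tau> L where \<tau>: "circle_real_analytic \<tau>" "L-lipschitz_on UNIV \<tau>" "\<And>c. \<bar>\<tau> c - tau c\<bar> < d"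
    using circle_real_analytic_approx[OF continuous_on_tau d(1)] by blast
  let ?A = "skew_map l \<tau>"
  have close1: "\<bar>\<tau> c - tau c\<bar> \<le> 1" for c using \<tau>(3)[of c] d by simp
  have distA: "dist (?A p) (skew_map l tau p) < d" for p
    using \<tau>(3)[of "fst p"] by (simp add: skew_map_def split_beta dist_prod_def dist_real_def)
  have cont_\<tau>: "continuous_on UNIV \<tau>" using \<tau>(2) by (rule lipschitz_on_continuous_on)
  \<comment> \<open>Serves twice: for the skew product itself, which gives the non-wandering set,
    and for the maps near it.\<close>
  have main: "interior (attractor U F) \<noteq> {} \<and> \<not> topological_annulus (attractor U F)"
    if U: "U = UNIV \<times> {- T<..<T}" "1 \<le> T" and F: "continuous_on (closure U) F" "F ` closure U \<subseteq> U"
      "\<And>p. p \<in> closure U \<Longrightarrow> dist (F p) (?A p) < d"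
      and hole: "(to_circle (1 / 2), 3 / (1 - l) + 2) \<notin> attractor U F" for U F T
  proof -
    have "closure U = UNIV \<times> {- T..T}" using U closure_strip[of T] by simp
    then have W: "W \<subseteq> closure U" using W_subset_strip U(2) by fastforce
    have "dist (F p) (skew_map l tau p) \<le> d0" if "p \<in> W" for p
      using F(3)[of p] distA[of p] dist_triangle[of "F p" "skew_map l tau p" "?A p"] d(2) W that by force
    then have "skew_map l tau (y, t) \<in> F ` W" if "\<bar>t\<bar> \<le> \<Lambda> (dist y 0) - \<eta> / l" for y t
      using that d0(2) continuous_on_subset[OF F(1) W] by blast
    from attractor_properties[OF this U F(2) hole] show ?thesis by blast
  qed
  define M where "M = H + 3"
  have M: "\<bar>\<tau> c\<bar> \<le> M" for c using close1[of c] tau_bound[of c] by (simp add: M_def)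
  \<comment> \<open>This makes \<open>(1 - l) * T\<close> exceed \<open>M\<close>, so the strip is
    trapping and its attractor is the non-wandering set.\<close>
  define T where "T = (M + 1) / (1 - l)"
  let ?U = "(UNIV :: circle set) \<times> {- T<..<T}"
  have MT: "(1 - l) * T = M + 1" using assms by (simp add: T_def)
  have "(M + 1) * (1 - l) \<le> (M + 1) * 1" using assms H_pos by (intro mult_left_mono) (auto simp: M_def)
  then have T: "1 \<le> T" using assms H_pos by (simp add: T_def M_def field_simps)
  have clU: "closure ?U = UNIV \<times> {- T..T}" using T by (intro closure_strip) simp
  have AU: "?A ` closure ?U \<subseteq> ?U"
  proof
    fix q assume "q \<in> ?A ` closure ?U"
    then obtain p where p: "q = ?A p" "\<bar>snd p\<bar> \<le> T" unfolding clU by (force simp: abs_le_iff)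
    have "l * \<bar>snd p\<bar> \<le> l * T" using p(2) assms by (intro mult_left_mono) auto
    moreover have "\<bar>l\<bar> = l" using assms by simp
    ultimately have "\<bar>snd q\<bar> < T"
      using abs_snd_skew_map_le[of l \<tau> p] M[of "fst p"] MT
      unfolding p(1) left_diff_distrib by linarith
    then show "q \<in> ?U" by (simp add: mem_Times_iff abs_less_iff)
  qed
  have nw: "nonwandering_set ?A = attractor ?U ?A"
    using assms cont_\<tau> M MT by (intro nonwandering_skew_map) auto
  have "(to_circle (1 / 2), 3 / (1 - l) + 2) \<notin> attractor ?U ?A"
    using hole_outside[of \<tau> T, OF close1] by (auto simp: attractor_def clU)
  then have "interior (attractor ?U ?A) \<noteq> {} \<and> \<not> topological_annulus (attractor ?U ?A)"
    using d(1) AU T continuous_on_skew_map[OF cont_\<tau>] by (intro main[of _ T]) auto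
  moreover have "\<exists>N. openin (Lip_into_topology U) N \<and> restrict ?A (closure U) \<in> N \<and>
      (\<forall>F\<in>N. interior (attractor U F) \<noteq> {} \<and> \<not> topological_annulus (attractor U F))"
    if T0: "0 < T0" and U: "U = UNIV \<times> {- T0<..<T0}" and AU: "?A ` closure U \<subseteq> U" for T0 U
  proof -
    have cl: "closure U = UNIV \<times> {- T0..T0}" using T0 closure_strip U by simp
    have ne: "U \<noteq> {}" using T0 by (auto simp: U)
    have cpt: "compact (closure U)" unfolding cl by (rule compact_strip)
    have AU': "?A ` closure U \<subseteq> closure U" using AU closure_subset by blast
    have contA: "continuous_on (closure U) ?A" by (rule continuous_on_skew_map[OF cont_\<tau>])
    \<comment> \<open>Trapping forces \<open>T0\<close> to be large: over 1/4 the upper boundary is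
      lifted by at least \<open>H - 1\<close>. Hence \<open>U\<close> contains
      \<open>W\<close>.\<close>
    have "?A (to_circle (1 / 4), T0) \<in> U" using AU T0 by (auto simp: cl)
    then have "l * T0 + \<tau> (to_circle (1 / 4)) < T0" by (simp add: U skew_map_def)
    moreover have "H - 1 \<le> \<tau> (to_circle (1 / 4))"
      using close1[of "to_circle (1 / 4)"] tau_quarter by simp
    moreover have "0 < l * T0" using assms T0 by simp
    ultimately have T1: "1 \<le> T0" using H_pos by linarith
    \<comment> \<open>The hole is already missed after \<open>N0\<close> steps, and therefore by
      nearby maps too.\<close>
    obtain N0 where "(to_circle (1 / 2), 3 / (1 - l) + 2) \<notin> (?A ^^ N0) ` closure U"
      using hole_outside[of \<tau> T0, OF close1] unfolding cl by blast
    then obtain d1 where d1: "d1 > 0" "\<And>F. F ` closure U \<subseteq> closure U \<Longrightarrow>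
        (\<forall>x\<in>closure U. dist (F x) (?A x) < d1) \<Longrightarrow>
        (to_circle (1 / 2), 3 / (1 - l) + 2) \<notin> (F ^^ N0) ` closure U"
      using not_in_image_stable[OF cpt contA AU'] by blast
    have "restrict ?A (closure U) \<in> Lip_into U"
      using skew_map_Lip[OF \<tau>(2)] AU by (auto simp: Lip_into_def)
    moreover have "0 < min d d1" using d d1 by simp
    ultimately obtain N where N: "openin (Lip_into_topology U) N" "restrict ?A (closure U) \<in> N"
      "\<And>F. F \<in> N \<Longrightarrow> F \<in> Lip_into U \<and>
        (\<forall>p\<in>closure U. dist (F p) (restrict ?A (closure U) p) < min d d1)"
      by (rule Lip_into_neighbourhood[OF cpt ne]) blast
    have "interior (attractor U F) \<noteq> {} \<and> \<not> topological_annulus (attractor U F)" if "F \<in> N" for F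
    proof (rule main[OF U T1])
      have F: "F \<in> Lip_into U" "\<And>p. p \<in> closure U \<Longrightarrow> dist (F p) (?A p) < min d d1"
        using N(3)[OF that] by auto
      then show "F ` closure U \<subseteq> U" by (simp add: Lip_into_def)
      show "continuous_on (closure U) F"
        using F(1) by (auto simp: Lip_into_def Lip_def intro: lipschitz_on_continuous_on)
      show "dist (F p) (?A p) < d" if "p \<in> closure U" for p using F(2)[OF that] by simp
      have "(to_circle (1 / 2), 3 / (1 - l) + 2) \<notin> (F ^^ N0) ` closure U"
        using F closure_subset[of U] by (intro d1(2)) (auto simp: Lip_into_def)
      then show "(to_circle (1 / 2), 3 / (1 - l) + 2) \<notin> attractor U F"
        unfolding attractor_def by blast
    qed
    then show ?thesis using N(1,2) by blast
  qed
  ultimately show ?thesis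
    using \<tau>(1) by (intro exI[of _ \<tau>] conjI allI impI) (simp_all only: nw, blast+)
qed

end
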